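(* Let $\tau(n)$ be the Ramanujan $\tau$-function, defined by $q\prod_{m=1}^{\infty}(1-q^m)^{24} = \sum_{n=1}^{\infty}\tau(n)q^n$, and let $F(s) = \sum_{n=1}^{\infty} \tau(n) n^{-s}$, extended to an entire function by analytic continuation. Write $s=\sigma+it$ with $\sigma,t$ real. For every $s$ with $6 < \sigma < \tfrac{13}{2}$ and $t \geq 3.8085$ such that $F(s)\neq 0$, one has $|F(12-s)| > |F(s)|$. *)

theory Defs
  imports "HOL-Complex_Analysis.Complex_Analysis"
begin

(* The infinite product is taken in the ring of formal power series over the integers with its
   usual (X-adic) topology; the index is shifted, so the factor with index m is (1 - q^(m+1))^24. *)
definition ramanujan_tau :: "nat \<Rightarrow> int" where
  "ramanujan_tau n =
     fps_nth (fps_X * (\<Prod>m. (1 - fps_X ^ Suc m) ^ 24)) n"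

(* The entire function that agrees with the Dirichlet series of tau on some right half-plane.
   By the identity theorem at most one function has this property. The half-plane
   is not specified, so no bound on the growth of tau is built into the definition. *)
definition ramanujan_L :: "complex \<Rightarrow> complex" where
  "ramanujan_L = (THE f. f holomorphic_on UNIV \<and>
     (\<exists>c::real. \<forall>s. Re s > c \<longrightarrow>
        (\<lambda>n. of_int (ramanujan_tau (Suc n)) * of_nat (Suc n) powr (- s)) sums f s))"

end

theory Submission
  imports Defs "HOL-Library.Nat_Bijection" "HOL-Real_Asymp.Real_Asymp"
begin

text \<open>
  Euler's pentagonal number theorem expresses the product defining \<open>\<tau>\<close> as the 24th power of a
  lacunary series with coefficients \<open>\<plusminus> 1\<close>, so \<open>\<tau>(n)\<close> grows polynomially and
  \<open>\<Delta>(i y) = \<eta>(y) ^ 24\<close> for a theta series \<open>\<eta>\<close>. Polya's limit of a finite trigonometric identity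
  for binomial coefficients gives \<open>\<eta>(1 / y) = sqrt y * \<eta>(y)\<close>. Substituting \<open>y = exp x\<close> in the Mellin
  transform turns it into a two-sided Laplace transform of a function decaying faster than every
  exponential; it is therefore entire, and \<open>x \<mapsto> - x\<close> yields the functional equation
  \<open>(2 \<pi>)\<^sup>-\<^sup>s \<Gamma>(s) F(s) = (2 \<pi>)\<^sup>s\<^sup>-\<^sup>1\<^sup>2 \<Gamma>(12 - s) F(12 - s)\<close>.

  With \<open>s = 6 + x + i t\<close> it remains to bound \<open>\<bar>\<Gamma>(6 + x + i t)\<bar> / \<bar>\<Gamma>(6 - x + i t)\<bar>\<close> below by
  \<open>(2 \<pi>) powr (2 x)\<close>. In Gauss's product this ratio increases with \<open>t\<close>, so \<open>t\<^sup>2 = 10\<close> suffices; there a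
  convexity argument bounds each factor by a telescoping quotient, which gives
  \<open>((11 / 2)\<^sup>2 + 10) powr x\<close>, and \<open>(11 / 2)\<^sup>2 + 10 > (2 \<pi>)\<^sup>2\<close>.
\<close>

section \<open>The pentagonal number theorem\<close>

text \<open>Shanks's finite form of Euler's theorem. In the induction step the last factor of each
  product splits \<open>T (Suc n) k\<close> into \<open>C k - B k\<close>, and the first factor
  gives \<open>C (Suc k) = T n (Suc k) + B k\<close>. The \<open>B\<close> terms telescope, leaving
  only \<open>B n\<close> and the new top term.\<close>

lemma shanks_identity:
  fixes x :: "'a :: comm_ring_1"
  shows "(\<Sum>k\<le>n. (- 1) ^ k * x ^ (n * k + triangle k) * (\<Prod>i\<in>{k<..n}. 1 - x ^ i)) =
    (\<Sum>j<n. (- 1) ^ j * (x ^ (j\<^sup>2 + triangle j) - x ^ ((Suc j)\<^sup>2 + triangle j)))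
      + (- 1) ^ n * x ^ (n\<^sup>2 + triangle n)"
proof (induction n)
  case 0
  show ?case by simp
next
  case (Suc n)
  define A where "A m k = (\<Prod>i\<in>{k<..m}. 1 - x ^ i)" for m k :: nat
  define B where "B k = (- 1) ^ k * x ^ (Suc n * Suc k + triangle k) * A n k" for k
  define T where "T m k = (- 1) ^ k * x ^ (m * k + triangle k) * A m k" for m k
  have A_Suc: "A (Suc n) k = A n k * (1 - x ^ Suc n)" if "k \<le> n" for k
  proof -
    have "{k<..Suc n} = insert (Suc n) {k<..n}" using that by auto
    then show ?thesis by (simp add: A_def)
  qed
  have A_left: "A n k = (1 - x ^ Suc k) * A n (Suc k)" if "k < n" for k
  proof -
    have "{k<..n} = insert (Suc k) {Suc k<..n}" using that by auto
    then show ?thesis by (simp add: A_def)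
  qed
  have A_refl [simp]: "A m m = 1" for m by (simp add: A_def)
  define C where "C k = (- 1) ^ k * x ^ (Suc n * k + triangle k) * A n k" for k
  have TSuc: "T (Suc n) k = C k - B k" if "k \<le> n" for k
    unfolding T_def B_def C_def A_Suc[OF that] by (simp add: algebra_simps power_add)
  have C0: "C 0 = T n 0" by (simp add: C_def T_def)
  have CSuc: "C (Suc k) = T n (Suc k) + B k" if "k < n" for k
    unfolding T_def B_def C_def A_left[OF that]
    by (simp add: algebra_simps power_add)
  have *: "(\<Sum>k\<le>m. C k) = (\<Sum>k\<le>m. T n k) + (\<Sum>k<m. B k)" if "m \<le> n" for m
    using that by (induction m) (simp_all add: C0 CSuc)
  have "(\<Sum>k\<le>Suc n. T (Suc n) k) = (\<Sum>k\<le>n. C k) - (\<Sum>k\<le>n. B k) + T (Suc n) (Suc n)"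
    by (simp add: TSuc sum_subtractf)
  also have "\<dots> = (\<Sum>k\<le>n. T n k) - B n + T (Suc n) (Suc n)"
    using sum.lessThan_Suc[of B n] by (simp add: *[OF order_refl] lessThan_Suc_atMost)
  also have "(\<Sum>k\<le>n. T n k) = (\<Sum>j<n. (- 1) ^ j * (x ^ (j\<^sup>2 + triangle j) - x ^ ((Suc j)\<^sup>2 + triangle j)))
      + (- 1) ^ n * x ^ (n\<^sup>2 + triangle n)"
    using Suc.IH by (simp add: T_def A_def)
  also have "\<dots> - B n + T (Suc n) (Suc n) =
    (\<Sum>j<Suc n. (- 1) ^ j * (x ^ (j\<^sup>2 + triangle j) - x ^ ((Suc j)\<^sup>2 + triangle j)))
      + (- 1) ^ Suc n * x ^ ((Suc n)\<^sup>2 + triangle (Suc n))"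
    by (simp add: T_def B_def algebra_simps power2_eq_square power_add)
  finally show ?case by (simp only: T_def A_def)
qed

text \<open>For injective \<open>g\<close> this is the lacunary series with terms (-1)^j X^(g j).
  Prescribing the coefficients avoids an infinite sum of formal power series.\<close>

definition alternating_fps :: "(nat \<Rightarrow> nat) \<Rightarrow> 'a :: comm_ring_1 fps" where
  "alternating_fps g = Abs_fps (\<lambda>n. if n \<in> range g then (- 1) ^ inv g n else 0)"

lemma alternating_fps_nth [simp]:
  assumes "strict_mono g"
  shows "fps_nth (alternating_fps g) (g j) = (- 1) ^ j"
  using assms by (simp add: alternating_fps_def strict_mono_imp_inj_on)

lemma alternating_fps_nth_eq_0: "n \<notin> range g \<Longrightarrow> fps_nth (alternating_fps g) n = 0"
  by (simp add: alternating_fps_def)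

lemma of_int_alternating_fps_nth:
  "of_int (fps_nth (alternating_fps g) n) = fps_nth (alternating_fps g) n"
  by (simp add: alternating_fps_def)

lemma norm_alternating_fps_nth_le:
  "norm (fps_nth (alternating_fps g :: 'a :: {comm_ring_1, real_normed_algebra_1} fps) n) \<le> 1"
  by (simp add: alternating_fps_def power_minus1_even uminus_power_if)

text \<open>As \<open>g\<close> increases strictly, the omitted terms start at degree
  \<open>g n\<close>. Below it, the finite sums from \<open>shanks_identity\<close> already show the
  coefficients of the full series.\<close>

lemma alternating_fps_partial_sum:
  assumes "strict_mono g" and "m < g n"
  shows "fps_nth (\<Sum>j<n. (- 1) ^ j * fps_X ^ g j) m =
    fps_nth (alternating_fps g :: 'a :: comm_ring_1 fps) m"
proof -
  have nth: "fps_nth ((- 1) ^ j * fps_X ^ g j :: 'a fps) m = (if m = g j then (- 1) ^ j else 0)" for j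
  proof -
    have "((- 1) ^ j :: 'a fps) = fps_const ((- 1) ^ j)"
      by (simp flip: fps_const_power fps_const_neg)
    then show ?thesis by (simp only: fps_mult_left_const_nth fps_X_power_nth) simp
  qed
  show ?thesis
  proof (cases "m \<in> range g")
    case True
    then obtain i where i: "m = g i" by blast
    have "i < n" using assms i by (simp add: strict_mono_less)
    have "m = g j \<longleftrightarrow> j = i" for j using assms(1) i by (auto simp: strict_mono_eq)
    moreover have "fps_nth (alternating_fps g :: 'a fps) m = (- 1) ^ i" by (simp add: i assms(1))
    ultimately show ?thesis using \<open>i < n\<close> by (simp add: fps_sum_nth nth)
  next
    case False
    then show ?thesis by (auto simp: fps_sum_nth nth alternating_fps_nth_eq_0 intro!: sum.neutral)
  qed
qed

text \<open>The exponents are the generalised pentagonal numbers \<open>j (3 j + 1) / 2\<close> and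
  \<open>(j + 1) (3 j + 2) / 2\<close>.\<close>
definition pentagonal_fps :: "'a :: comm_ring_1 fps" where
  "pentagonal_fps = alternating_fps (\<lambda>j. j\<^sup>2 + triangle j)
     - alternating_fps (\<lambda>j. (Suc j)\<^sup>2 + triangle j)"

lemma strict_mono_pentagonal:
  "strict_mono (\<lambda>j. j\<^sup>2 + triangle j)" "strict_mono (\<lambda>j. (Suc j)\<^sup>2 + triangle j)"
  by (rule strict_monoI_Suc; simp add: power2_eq_square)+

text \<open>In Shanks's identity at x = X, every summand with k > 0 carries the factor X^(n k +
  triangle k), of degree above n. Up to degree n only the product at k = 0 is visible.\<close>

lemma pentagonal_number_theorem_nth:
  assumes "m \<le> n"
  shows "fps_nth (\<Prod>i<n. 1 - fps_X ^ Suc i) m = fps_nth (pentagonal_fps :: 'a :: comm_ring_1 fps) m"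
proof -
  have n_le: "n \<le> n\<^sup>2" by (simp add: power2_eq_square)
  define P where "P k = (- 1) ^ k * fps_X ^ (n * k + triangle k) * (\<Prod>i\<in>{k<..n}. 1 - fps_X ^ i :: 'a fps)" for k
  have higher: "fps_nth (P k) m = 0" if k: "k \<noteq> 0" for k
  proof -
    have "m < n * k + triangle k"
    proof -
      obtain l where "k = Suc l" using not0_implies_Suc[OF k] by blast
      then show ?thesis using assms by simp
    qed
    moreover have "P k = fps_X ^ (n * k + triangle k) *
        ((- 1) ^ k * (\<Prod>i\<in>{k<..n}. 1 - fps_X ^ i))"
      unfolding P_def by (simp only: mult_ac)
    ultimately show ?thesis
      by (simp only: fps_X_power_mult_nth if_True)
  qed
  have "fps_nth (\<Sum>k\<le>n. P k) m = (\<Sum>k\<in>{0}. fps_nth (P k) m)"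
    unfolding fps_sum_nth by (intro sum.mono_neutral_right) (auto simp: higher)
  also have "(\<Sum>k\<in>{0}. fps_nth (P k) m) = fps_nth (\<Prod>i\<in>{0<..n}. 1 - fps_X ^ i) m"
    by (simp add: P_def)
  also have "{0<..n} = Suc ` {..<n}"
    by (auto simp: image_Suc_lessThan)
  also have "(\<Prod>i\<in>Suc ` {..<n}. 1 - fps_X ^ i) = (\<Prod>i<n. 1 - fps_X ^ Suc i :: 'a fps)"
    by (subst prod.reindex) auto
  finally have "fps_nth (\<Prod>i<n. 1 - fps_X ^ Suc i) m = fps_nth (\<Sum>k\<le>n. P k) m" ..
  \<comment> \<open>The last term of the identity extends the first alternating sum to j = n, which
    is why that sum runs over \<open>j < Suc n\<close>.\<close>
  also have "(\<Sum>k\<le>n. P k) = (\<Sum>j<Suc n. (- 1) ^ j * fps_X ^ (j\<^sup>2 + triangle j))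
      - (\<Sum>j<n. (- 1) ^ j * fps_X ^ ((Suc j)\<^sup>2 + triangle j))"
    unfolding P_def shanks_identity by (simp add: algebra_simps sum_subtractf sum.distrib)
  also have "fps_nth \<dots> m = fps_nth (pentagonal_fps :: 'a fps) m"
  proof -
    have "m < (Suc n)\<^sup>2 + triangle (Suc n)" "m < (Suc n)\<^sup>2 + triangle n"
      using assms n_le by (simp_all add: power2_eq_square)
    then show ?thesis
      unfolding fps_sub_nth pentagonal_fps_def
      by (subst (1 2) alternating_fps_partial_sum) (auto intro: strict_mono_pentagonal)
  qed
  finally show ?thesis .
qed

section \<open>The infinite product and polynomial growth of tau\<close>

lemma fps_nth_power_cong:
  fixes f g :: "'a :: comm_ring_1 fps"
  assumes "\<And>i. i \<le> m \<Longrightarrow> fps_nth f i = fps_nth g i" "i \<le> m"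
  shows "fps_nth (f ^ k) i = fps_nth (g ^ k) i"
  using assms(2)
proof (induction k arbitrary: i)
  case (Suc k)
  then show ?case by (auto simp: fps_mult_nth assms(1) intro!: sum.cong)
qed simp

text \<open>Each coefficient of the partial products is eventually constant, which is convergence in
  the X-adic topology. The constant coefficient 1 keeps the limit nonzero, as
  \<open>raw_has_prod\<close> demands.\<close>

lemma prodinf_eq_pentagonal_power:
  "(\<Prod>m. (1 - fps_X ^ Suc m) ^ k) = (pentagonal_fps ^ k :: int fps)"
proof -
  have nth0: "fps_nth (pentagonal_fps ^ k :: int fps) 0 = 1"
  proof -
    have "fps_nth (\<Prod>i<0. 1 - fps_X ^ Suc i :: int fps) 0 = fps_nth pentagonal_fps 0"
      by (rule pentagonal_number_theorem_nth) simp
    then show ?thesis by (simp add: fps_nth_power_0)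
  qed
  have "(\<lambda>n. \<Prod>i\<le>n. (1 - fps_X ^ Suc (i + 0)) ^ k) \<longlonglongrightarrow> (pentagonal_fps ^ k :: int fps)"
  proof (rule tendsto_fpsI)
    fix m
    have "fps_nth (\<Prod>i\<le>n. (1 - fps_X ^ Suc (i + 0)) ^ k :: int fps) m = fps_nth (pentagonal_fps ^ k) m"
      if "n \<ge> m" for n
      unfolding prod_power_distrib[symmetric] add_0_right
      by (rule fps_nth_power_cong[of m])
         (use that in \<open>auto simp: lessThan_Suc_atMost[symmetric] simp del: prod.lessThan_Suc power_Suc intro!: pentagonal_number_theorem_nth\<close>)
    then show "\<forall>\<^sub>F n in sequentially.
        fps_nth (\<Prod>i\<le>n. (1 - fps_X ^ Suc (i + 0)) ^ k :: int fps) m = fps_nth (pentagonal_fps ^ k) m"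
      using eventually_ge_at_top[of m] by (rule eventually_mono[rotated])
  qed
  moreover have "pentagonal_fps ^ k \<noteq> (0 :: int fps)"
    using nth0 by (metis fps_zero_nth zero_neq_one)
  ultimately show ?thesis
    by (intro has_prod_unique[symmetric]) (auto simp: has_prod_def raw_has_prod_def)
qed

lemma ramanujan_tau_Suc: "ramanujan_tau (Suc n) = fps_nth (pentagonal_fps ^ 24) n"
  unfolding ramanujan_tau_def prodinf_eq_pentagonal_power by simp

lemma of_int_pentagonal_power_nth:
  "of_int (fps_nth (pentagonal_fps ^ k) n) = fps_nth (pentagonal_fps ^ k :: 'a :: comm_ring_1 fps) n"
proof (induction k arbitrary: n)
  case (Suc k)
  have "of_int (fps_nth pentagonal_fps n) = fps_nth (pentagonal_fps :: 'a fps) n" for n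
    by (simp add: pentagonal_fps_def of_int_alternating_fps_nth)
  with Suc show ?case by (simp add: fps_mult_nth)
qed simp

lemma norm_pentagonal_fps_nth_le:
  "norm (fps_nth (pentagonal_fps :: 'a :: {comm_ring_1, real_normed_algebra_1} fps) n) \<le> 2"
proof -
  have "norm (fps_nth (pentagonal_fps :: 'a fps) n) \<le>
      norm (fps_nth (alternating_fps (\<lambda>j. j\<^sup>2 + triangle j) :: 'a fps) n)
      + norm (fps_nth (alternating_fps (\<lambda>j. (Suc j)\<^sup>2 + triangle j) :: 'a fps) n)"
    unfolding pentagonal_fps_def fps_sub_nth by (rule norm_triangle_ineq4)
  also have "\<dots> \<le> 1 + 1" by (intro add_mono norm_alternating_fps_nth_le)
  finally show ?thesis by simp
qed

lemma pentagonal_power_nth_le: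
  "\<bar>fps_nth (pentagonal_fps ^ k) n\<bar> \<le> (2 * (real n + 1)) ^ k"
proof (induction k arbitrary: n)
  case 0
  show ?case by simp
next
  case (Suc k)
  have "\<bar>fps_nth (pentagonal_fps ^ Suc k :: real fps) n\<bar> \<le> (\<Sum>i=0..n. \<bar>fps_nth pentagonal_fps i * fps_nth (pentagonal_fps ^ k) (n - i)\<bar>)"
    unfolding power_Suc fps_mult_nth by (rule sum_abs)
  also have "\<dots> \<le> (\<Sum>i=0..n. 2 * (2 * (real n + 1)) ^ k)"
  proof (rule sum_mono)
    fix i
    have "\<bar>fps_nth (pentagonal_fps ^ k :: real fps) (n - i)\<bar> \<le> (2 * (real (n - i) + 1)) ^ k" by (rule Suc.IH)
    also have "\<dots> \<le> (2 * (real n + 1)) ^ k" by (intro power_mono) auto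
    finally show "\<bar>fps_nth pentagonal_fps i * fps_nth (pentagonal_fps ^ k) (n - i)\<bar>
        \<le> 2 * (2 * (real n + 1)) ^ k"
      unfolding abs_mult using norm_pentagonal_fps_nth_le[where 'a = real, of i]
      by (intro mult_mono) auto
  qed
  also have "\<dots> = (2 * (real n + 1)) ^ Suc k" by simp
  finally show ?case .
qed

text \<open>Far from sharp, but any polynomial bound gives a half-plane of absolute convergence, and
  the definition of \<open>ramanujan_L\<close> leaves the half-plane open.\<close>

lemma ramanujan_tau_bound: "\<bar>of_int (ramanujan_tau (Suc n))\<bar> \<le> 2 ^ 24 * (real (Suc n)) ^ 24"
proof -
  have "\<bar>of_int (ramanujan_tau (Suc n))\<bar> = \<bar>fps_nth (pentagonal_fps ^ 24 :: real fps) n\<bar>"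
    unfolding ramanujan_tau_Suc of_int_pentagonal_power_nth ..
  also have "\<dots> \<le> (2 * (real n + 1)) ^ 24" by (rule pentagonal_power_nth_le)
  also have "\<dots> = 2 ^ 24 * (real (Suc n)) ^ 24"
    unfolding power_mult_distrib of_nat_Suc by (simp only: add.commute[of 1])
  finally show ?thesis .
qed

section \<open>The theta transformation\<close>

text \<open>Expand \<open>(cis \<theta> + cis (- \<theta>)) ^ (2 * m)\<close> binomially, multiply
  by \<open>cis (- (2 * real r * \<theta>))\<close> and compare real parts.\<close>

lemma two_cos_power_even_times_cos:
  "(2 * cos \<theta>) ^ (2 * m) * cos (2 * real r * \<theta>) =
    (\<Sum>i\<le>2 * m. real (2 * m choose i) * cos (2 * (real i - real m - real r) * \<theta>))"
proof -
  have "complex_of_real ((2 * cos \<theta>) ^ (2 * m)) = (cis \<theta> + cis (- \<theta>)) ^ (2 * m)"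
  proof -
    have "complex_of_real (2 * cos \<theta>) = cis \<theta> + cis (- \<theta>)"
      by (simp add: complex_eq_iff)
    then show ?thesis by (simp only: of_real_power)
  qed
  also have "\<dots> = (\<Sum>i\<le>2 * m. of_nat (2 * m choose i) * cis (2 * (real i - real m) * \<theta>))"
    unfolding binomial_ring
  proof (rule sum.cong[OF refl])
    fix i assume "i \<in> {..2 * m}"
    then have "real i * \<theta> + real (2 * m - i) * (- \<theta>) = 2 * (real i - real m) * \<theta>"
      by (simp add: of_nat_diff algebra_simps)
    then have *: "cis \<theta> ^ i * cis (- \<theta>) ^ (2 * m - i) = cis (2 * (real i - real m) * \<theta>)"
      by (simp only: Complex.DeMoivre cis_mult)
    show "of_nat (2 * m choose i) * cis \<theta> ^ i * cis (- \<theta>) ^ (2 * m - i) =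
        of_nat (2 * m choose i) * cis (2 * (real i - real m) * \<theta>)"
      unfolding *[symmetric] by (simp only: mult.assoc)
  qed
  finally have "complex_of_real ((2 * cos \<theta>) ^ (2 * m)) * cis (- (2 * real r * \<theta>)) =
      (\<Sum>i\<le>2 * m. of_nat (2 * m choose i) * cis (2 * (real i - real m - real r) * \<theta>))"
    by (simp only: sum_distrib_right mult.assoc cis_mult) (simp add: algebra_simps)
  then have "Re (complex_of_real ((2 * cos \<theta>) ^ (2 * m)) * cis (- (2 * real r * \<theta>))) =
      Re (\<Sum>i\<le>2 * m. of_nat (2 * m choose i) * cis (2 * (real i - real m - real r) * \<theta>))"
    by (rule arg_cong)
  moreover have "Re (complex_of_real c * cis (- x)) = c * cos x" "Re (of_nat n * cis x) = real n * cos x"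
    for c x n by simp_all
  ultimately show ?thesis by (simp only: Re_sum)
qed

text \<open>Orthogonality for the roots of z^l = -1: real parts of their d-th powers are summed. If
  l divides d, all terms agree. Otherwise multiplication by 2 sin a with a = pi d / l makes the sum
  telescope to sin (2 pi d) - sin 0 = 0, while sin a is nonzero.\<close>

lemma sum_cos_odd_multiples:
  fixes l :: nat and d :: int
  assumes "l > 0"
  shows "(\<Sum>j<l. cos (pi * d * (2 * real j + 1) / l)) =
    (if int l dvd d then (- 1) ^ nat \<bar>d div int l\<bar> * real l else 0)"
proof (cases "int l dvd d")
  case True
  then obtain k where k: "d = int l * k" by (elim dvdE)
  have "cos (pi * d * (2 * real j + 1) / l) = (- 1) ^ nat \<bar>k\<bar>" for j
  proof -
    have "pi * d * (2 * real j + 1) / l = pi * of_int (k * (2 * int j + 1))"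
      using assms by (simp add: k field_simps)
    also have "cos \<dots> = (if even k then 1 else - 1)"
      using cos_npi_int[of "k * (2 * int j + 1)"] by simp
    also have "\<dots> = (- 1) ^ nat \<bar>k\<bar>"
      by (simp add: minus_one_power_iff even_nat_iff)
    finally show ?thesis .
  qed
  then show ?thesis using assms True by (simp add: k)
next
  case False
  define a where "a = pi * d / l"
  have tele: "2 * sin a * cos (a * (2 * real j + 1)) = sin (2 * real (Suc j) * a) - sin (2 * real j * a)" for j
  proof -
    define b where "b = a * (2 * real j + 1)"
    have "2 * real (Suc j) * a = b + a" "2 * real j * a = b - a" by (simp_all add: b_def algebra_simps)
    then show ?thesis unfolding b_def[symmetric] by (simp only: sin_add sin_diff) simp
  qed
  have "2 * sin a * (\<Sum>j<l. cos (a * (2 * real j + 1))) = sin (2 * real l * a) - sin (2 * real 0 * a)"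
    unfolding sum_distrib_left tele by (rule sum_lessThan_telescope)
  also have "2 * real l * a = 2 * pi * of_int d" using assms by (simp add: a_def)
  also have "sin (2 * pi * of_int d) = 0" by (rule sin_int_2pin)
  finally have "2 * sin a * (\<Sum>j<l. cos (a * (2 * real j + 1))) = 0" by simp
  moreover have "sin a \<noteq> 0"
  proof
    assume "sin a = 0"
    then obtain k :: int where "a = of_int k * pi" by (auto simp: sin_zero_iff_int2)
    then have "real_of_int d = real_of_int (int l * k)" using assms by (simp add: a_def field_simps)
    then have "d = int l * k" by (simp only: of_int_eq_iff)
    with False show False by simp
  qed
  ultimately show ?thesis using False by (simp add: a_def mult.assoc)
qed

text \<open>The probability that a simple random walk is at position 2 d after 2 m steps.\<close>

definition central_binomial_ratio :: "nat \<Rightarrow> nat \<Rightarrow> real" where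
  "central_binomial_ratio m d = real (2 * m choose (m + d)) / 4 ^ m"

lemma central_binomial_ratio_eq_0: "m < d \<Longrightarrow> central_binomial_ratio m d = 0"
  by (simp add: central_binomial_ratio_def)

text \<open>Polya's route to the theta transformation: average a power of the cosine over the roots
  of \<open>z ^ (6 r) = - 1\<close>.\<close>
lemma polya_identity:
  assumes "r > 0"
  shows "(\<Sum>j<6 * r. cos (pi * (2 * real j + 1) / (12 * r)) ^ (2 * m) * cos (pi * (2 * real j + 1) / 6)) =
    6 * r * (\<Sum>k. (- 1) ^ k * (central_binomial_ratio m ((6 * k + 1) * r)
                                - central_binomial_ratio m ((6 * k + 5) * r)))"
proof -
  \<comment> \<open>The numbers \<open>cis (2 * \<theta> j)\<close> are the roots of z^(6 r) = -1,
    while 2 r times the angle is pi (2 j + 1) / 6. The latter is independent of r and survives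
    unchanged in the limit.\<close>
  define \<theta> where "\<theta> j = pi * (2 * real j + 1) / (12 * r)" for j :: nat
  define l where "l = 6 * r"
  define C where "C i = real (2 * m choose i)" for i
  define e where "e i = int i - int m - int r" for i
  define S where "S = (\<Sum>j<l. (2 * cos (\<theta> j)) ^ (2 * m) * cos (2 * real r * \<theta> j))"
  have "l > 0" using assms by (simp add: l_def)
  have "S = (\<Sum>i\<le>2 * m. C i * (\<Sum>j<l. cos (pi * e i * (2 * real j + 1) / l)))"
    unfolding S_def two_cos_power_even_times_cos sum_distrib_left
  proof (subst sum.swap, intro sum.cong refl)
    fix i j
    have "2 * (real i - real m - real r) * \<theta> j = pi * e i * (2 * real j + 1) / l"
    proof -
      have "2 * A * (B / (12 * real r)) = A * B / (6 * real r)" for A B :: real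
        by simp
      from this[of "real i - real m - real r" "pi * (2 * real j + 1)"]
      show ?thesis by (simp add: e_def \<theta>_def l_def mult_ac)
    qed
    then show "real (2 * m choose i) * cos (2 * (real i - real m - real r) * \<theta> j) =
        C i * cos (pi * e i * (2 * real j + 1) / l)"
      by (simp only: C_def)
  qed
  also have "\<dots> = (\<Sum>i | i \<le> 2 * m \<and> int l dvd e i. C i * ((- 1) ^ nat \<bar>e i div int l\<bar> * l))"
    unfolding sum_cos_odd_multiples[OF \<open>l > 0\<close>]
    by (intro sum.mono_neutral_cong_right) auto
  \<comment> \<open>A frequency survives exactly when i - m is r times an integer congruent to 1
    modulo 6. Nonnegative quotients give offsets (6 k + 1) r above m, negative ones offsets (6 k +
    5) r below it.\<close>
  also have "{i. i \<le> 2 * m \<and> int l dvd e i} =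
      (\<lambda>k. m + (6 * k + 1) * r) ` {k. (6 * k + 1) * r \<le> m}
      \<union> (\<lambda>k. m - (6 * k + 5) * r) ` {k. (6 * k + 5) * r \<le> m}" (is "?I = ?A \<union> ?B")
  proof (intro equalityI subsetI)
    fix i assume "i \<in> ?I"
    then obtain k where i: "i \<le> 2 * m" "e i = int l * k" by (auto elim!: dvdE)
    show "i \<in> ?A \<union> ?B"
    proof (cases "k \<ge> 0")
      case True
      then obtain n where "k = int n" using nonneg_int_cases by blast
      with i have "int i = int (m + (6 * n + 1) * r)" by (simp add: e_def l_def algebra_simps)
      then have "i = m + (6 * n + 1) * r" by (simp only: of_nat_eq_iff)
      with i(1) show ?thesis by auto
    next
      case False
      define n where "n = nat (- k - 1)"
      have "k = - int n - 1" using False by (simp add: n_def)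
      with i have "int m = int (i + (6 * n + 5) * r)" by (simp add: e_def l_def algebra_simps)
      then have "m = i + (6 * n + 5) * r" by (simp only: of_nat_eq_iff)
      then show ?thesis by (intro UnI2 image_eqI[of _ _ n]) auto
    qed
  next
    fix i assume "i \<in> ?A \<union> ?B"
    then show "i \<in> ?I"
    proof
      assume "i \<in> ?A"
      then obtain k where k: "i = m + (6 * k + 1) * r" "(6 * k + 1) * r \<le> m" by auto
      then have "e i = int l * int k" by (simp add: e_def l_def algebra_simps)
      with k show ?thesis by simp
    next
      assume "i \<in> ?B"
      then obtain k where k: "i = m - (6 * k + 5) * r" "(6 * k + 5) * r \<le> m" by auto
      then have "e i = int l * (- int k - 1)" by (simp add: e_def l_def of_nat_diff algebra_simps)
      with k show ?thesis by simp
    qed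
  qed
  also have "(\<Sum>i\<in>?A \<union> ?B. C i * ((- 1) ^ nat \<bar>e i div int l\<bar> * l)) =
      (\<Sum>i\<in>?A. C i * ((- 1) ^ nat \<bar>e i div int l\<bar> * l)) + (\<Sum>i\<in>?B. C i * ((- 1) ^ nat \<bar>e i div int l\<bar> * l))"
  proof (rule sum.union_disjoint)
    have fin: "finite {k. (6 * k + a) * r \<le> m}" for a :: nat
    proof (rule finite_subset)
      show "{k. (6 * k + a) * r \<le> m} \<subseteq> {..m}"
      proof
        fix k assume "k \<in> {k. (6 * k + a) * r \<le> m}"
        moreover have "k \<le> (6 * k + a) * r" using assms by (cases r) auto
        ultimately show "k \<in> {..m}" by simp
      qed
    qed simp
    show "finite ?A" "finite ?B" by (intro finite_imageI fin)+
    show "?A \<inter> ?B = {}" using assms by auto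
  qed
  also have "(\<Sum>i\<in>?A. C i * ((- 1) ^ nat \<bar>e i div int l\<bar> * l)) =
      (\<Sum>k | (6 * k + 1) * r \<le> m. (- 1) ^ k * real l * C (m + (6 * k + 1) * r))"
  proof (subst sum.reindex)
    show "inj_on (\<lambda>k. m + (6 * k + 1) * r) {k. (6 * k + 1) * r \<le> m}"
      using assms by (auto intro!: inj_onI)
    have "e (m + (6 * k + 1) * r) div int l = int k" for k
    proof -
      have "e (m + (6 * k + 1) * r) = int k * int l" by (simp add: e_def l_def algebra_simps)
      then show ?thesis using \<open>l > 0\<close> by simp
    qed
    then show "sum ((\<lambda>i. C i * ((- 1) ^ nat \<bar>e i div int l\<bar> * l)) \<circ> (\<lambda>k. m + (6 * k + 1) * r)) {k. (6 * k + 1) * r \<le> m} =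
       (\<Sum>k | (6 * k + 1) * r \<le> m. (- 1) ^ k * real l * C (m + (6 * k + 1) * r))"
      by (simp only: comp_def) (simp add: mult_ac)
  qed
  also have "(\<Sum>i\<in>?B. C i * ((- 1) ^ nat \<bar>e i div int l\<bar> * l)) =
      (\<Sum>k | (6 * k + 5) * r \<le> m. - ((- 1) ^ k * real l * C (m + (6 * k + 5) * r)))"
  proof (subst sum.reindex)
    show "inj_on (\<lambda>k. m - (6 * k + 5) * r) {k. (6 * k + 5) * r \<le> m}"
    proof (rule inj_onI, goal_cases)
      case (1 x y)
      then have "(6 * x + 5) * r = (6 * y + 5) * r" by (simp only: mem_Collect_eq eq_diff_iff)
      then show ?case using assms by simp
    qed
    \<comment> \<open>The quotient is -(k + 1), so its sign is opposite to (-1)^k: this is the minus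
      sign between the two families.\<close>
    have "nat \<bar>e (m - (6 * k + 5) * r) div int l\<bar> = Suc k" if "(6 * k + 5) * r \<le> m" for k
    proof -
      have "e (m - (6 * k + 5) * r) = - int (Suc k) * int l"
        using that by (simp add: e_def l_def of_nat_diff algebra_simps)
      then have "e (m - (6 * k + 5) * r) div int l = - int (Suc k)"
        using \<open>l > 0\<close> by (simp only: nonzero_mult_div_cancel_right of_nat_eq_0_iff)
      then show ?thesis by (simp only: abs_minus_cancel abs_of_nat nat_int)
    qed
    moreover have "C (m - d) = C (m + d)" if "d \<le> m" for d
      using that binomial_symmetric[of "m - d" "2 * m"] by (simp add: C_def)
    ultimately show "sum ((\<lambda>i. C i * ((- 1) ^ nat \<bar>e i div int l\<bar> * l)) \<circ> (\<lambda>k. m - (6 * k + 5) * r)) {k. (6 * k + 5) * r \<le> m} =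
       (\<Sum>k | (6 * k + 5) * r \<le> m. - ((- 1) ^ k * real l * C (m + (6 * k + 5) * r)))"
      by (intro sum.cong refl) (simp only: comp_def mem_Collect_eq, simp)
  qed
  finally have S: "S = (\<Sum>k | (6 * k + 1) * r \<le> m. (- 1) ^ k * real l * C (m + (6 * k + 1) * r))
      + (\<Sum>k | (6 * k + 5) * r \<le> m. - ((- 1) ^ k * real l * C (m + (6 * k + 5) * r)))" .
  have le: "k \<le> m" if "(6 * k + a) * r \<le> m" for k a
  proof -
    have "k \<le> (6 * k + a) * r" using assms by (cases r) auto
    with that show ?thesis by simp
  qed
  \<comment> \<open>For the added indices the lower entry exceeds 2 m and the binomial coefficient
    vanishes. The same vanishing later turns the finite sum into a series.\<close>
  have extend1: "(\<Sum>k | (6 * k + 1) * r \<le> m. (- 1) ^ k * real l * C (m + (6 * k + 1) * r)) =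
      (\<Sum>k\<le>m. (- 1) ^ k * real l * C (m + (6 * k + 1) * r))"
    using le[of _ 1] by (intro sum.mono_neutral_left) (auto simp: C_def)
  have extend5: "(\<Sum>k | (6 * k + 5) * r \<le> m. - ((- 1) ^ k * real l * C (m + (6 * k + 5) * r))) =
      (\<Sum>k\<le>m. - ((- 1) ^ k * real l * C (m + (6 * k + 5) * r)))"
    using le[of _ 5] by (intro sum.mono_neutral_left) (auto simp: C_def)
  have "S = real l * (\<Sum>k\<le>m. (- 1) ^ k * (C (m + (6 * k + 1) * r) - C (m + (6 * k + 5) * r)))"
  proof -
    have "(\<Sum>k\<le>m. (- 1) ^ k * real l * a k) + (\<Sum>k\<le>m. - ((- 1) ^ k * real l * b k)) =
        real l * (\<Sum>k\<le>m. (- 1) ^ k * (a k - b k))" for a b :: "nat \<Rightarrow> real"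
      unfolding sum.distrib[symmetric] sum_distrib_left by (intro sum.cong) (simp_all add: algebra_simps)
    from this[of "\<lambda>k. C (m + (6 * k + 1) * r)" "\<lambda>k. C (m + (6 * k + 5) * r)"]
    show ?thesis unfolding S extend1 extend5 .
  qed
  also have "\<dots> = 4 ^ m * (real l * (\<Sum>k\<le>m. (- 1) ^ k * (central_binomial_ratio m ((6 * k + 1) * r)
                                - central_binomial_ratio m ((6 * k + 5) * r))))"
  proof -
    have "C (m + d) = 4 ^ m * central_binomial_ratio m d" for d
      by (simp add: C_def central_binomial_ratio_def)
    then show ?thesis
      by (simp only: sum_distrib_left right_diff_distrib mult.left_commute[of _ "4 ^ m"])
  qed
  also have "(\<Sum>k\<le>m. (- 1) ^ k * (central_binomial_ratio m ((6 * k + 1) * r)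
                                - central_binomial_ratio m ((6 * k + 5) * r))) =
     (\<Sum>k. (- 1) ^ k * (central_binomial_ratio m ((6 * k + 1) * r)
                                - central_binomial_ratio m ((6 * k + 5) * r)))"
  proof (rule suminf_finite[symmetric])
    fix k assume "k \<notin> {..m}"
    then have "m < (6 * k + a) * r" for a using le[of k a] by (meson atMost_iff not_le)
    then show "(- 1) ^ k * (central_binomial_ratio m ((6 * k + 1) * r)
                                - central_binomial_ratio m ((6 * k + 5) * r)) = 0"
      by (simp only: central_binomial_ratio_eq_0) simp
  qed simp
  finally have "S / 4 ^ m = real l * (\<Sum>k. (- 1) ^ k * (central_binomial_ratio m ((6 * k + 1) * r)
                                - central_binomial_ratio m ((6 * k + 5) * r)))"
    by simp
  moreover have "S / 4 ^ m = (\<Sum>j<6 * r. cos (pi * (2 * real j + 1) / (12 * r)) ^ (2 * m) * cos (pi * (2 * real j + 1) / 6))"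
  proof -
    have "2 * real r * \<theta> j = pi * (2 * real j + 1) / 6" for j
      using assms by (simp add: \<theta>_def field_simps)
    then show ?thesis
      unfolding S_def sum_divide_distrib
      by (simp add: l_def \<theta>_def power_mult_distrib power_mult[of 2 2 m])
  qed
  ultimately show ?thesis by (simp add: l_def)
qed

text \<open>Under j -> 6 r - 1 - j the first angle goes to pi minus itself, harmless for an even
  power, and the second to its negative modulo 2 pi. The remaining angles lie in [0, pi/2], where
  the cosine powers have a Gaussian bound.\<close>

lemma polya_identity_half:
  assumes "r > 0"
  shows "(\<Sum>j<6 * r. cos (pi * (2 * real j + 1) / (12 * r)) ^ (2 * m) * cos (pi * (2 * real j + 1) / 6)) =
    2 * (\<Sum>j<3 * r. cos (pi * (2 * real j + 1) / (12 * r)) ^ (2 * m) * cos (pi * (2 * real j + 1) / 6))"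
proof -
  define f where "f j = cos (pi * (2 * real j + 1) / (12 * r)) ^ (2 * m) * cos (pi * (2 * real j + 1) / 6)"
    for j :: nat
  have sym: "f (6 * r - 1 - j) = f j" if "j < 3 * r" for j
  proof -
    have j: "real (6 * r - 1 - j) = 6 * real r - 1 - real j" using that by (simp add: of_nat_diff)
    have 1: "pi * (2 * real (6 * r - 1 - j) + 1) / real (12 * r) = pi - pi * (2 * real j + 1) / real (12 * r)"
      using assms unfolding j by (simp add: field_simps)
    have 2: "pi * (2 * real (6 * r - 1 - j) + 1) / 6 = 2 * pi * r - pi * (2 * real j + 1) / 6"
      unfolding j by (simp add: field_simps)
    have 3: "cos (2 * pi * r - x) = cos x" for x
      using cos_int_2pin[of "int r"] sin_int_2pin[of "int r"] by (simp add: cos_diff)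
    show ?thesis unfolding f_def 1 2 3 by (simp add: power_mult)
  qed
  have "(\<Sum>j<6 * r. f j) = (\<Sum>j<3 * r. f j) + (\<Sum>j\<in>{3 * r..<6 * r}. f j)"
    by (subst sum.union_disjoint[symmetric]) (auto intro: sum.cong)
  also have "(\<Sum>j\<in>{3 * r..<6 * r}. f j) = (\<Sum>j<3 * r. f (6 * r - 1 - j))"
    by (rule sum.reindex_bij_witness[of _ "\<lambda>j. 6 * r - 1 - j" "\<lambda>j. 6 * r - 1 - j"]) auto
  also have "\<dots> = (\<Sum>j<3 * r. f j)" by (intro sum.cong sym) auto
  finally show ?thesis by (simp add: f_def)
qed

text \<open>Dedekind's eta function at i y, as the theta series of the even character modulo 12:
  residues 1 and 11 count positively, 5 and 7 negatively.\<close>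

definition eta_series :: "real \<Rightarrow> real" where
  "eta_series y = (\<Sum>k. (- 1) ^ k * (exp (- (pi * y * (6 * real k + 1)\<^sup>2 / 12))
                                   - exp (- (pi * y * (6 * real k + 5)\<^sup>2 / 12))))"

section \<open>Gaussian limits of binomial coefficients and cosine powers\<close>

lemma tannery_uniform:
  fixes a :: "nat \<Rightarrow> nat \<Rightarrow> real"
  assumes "\<And>k. (\<lambda>n. a k n) \<longlonglongrightarrow> b k"
    and "eventually (\<lambda>n. \<forall>k. norm (a k n) \<le> M k) sequentially" and "summable M"
  shows "summable b" "(\<lambda>n. \<Sum>k. a k n) \<longlonglongrightarrow> (\<Sum>k. b k)"
proof -
  have "eventually (\<lambda>(k, n). norm (a k n) \<le> M k) (at_top \<times>\<^sub>F sequentially)"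
    unfolding eventually_prod_filter
    by (intro exI[of _ "\<lambda>_. True"] exI[of _ "\<lambda>n. \<forall>k. norm (a k n) \<le> M k"]) (use assms(2) in auto)
  from tannerys_theorem[OF assms(1) this assms(3)]
  show "summable b" "(\<lambda>n. \<Sum>k. a k n) \<longlonglongrightarrow> (\<Sum>k. b k)"
    by (auto intro: summable_norm_cancel)
qed

text \<open>Since ln (1 - v) / v tends to -1 as v falls to 0, the logarithm of the power has the
  same limit as -k u. Binomial products and cosine powers both take this form.\<close>

lemma tendsto_one_minus_power:
  fixes u :: "nat \<Rightarrow> real" and k :: "nat \<Rightarrow> nat"
  assumes "u \<longlonglongrightarrow> 0" "eventually (\<lambda>n. u n > 0) sequentially"
    and "(\<lambda>n. real (k n) * u n) \<longlonglongrightarrow> K"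
  shows "(\<lambda>n. (1 - u n) ^ k n) \<longlonglongrightarrow> exp (- K)"
proof -
  have "((\<lambda>v::real. ln (1 - v) / v) \<longlongrightarrow> - 1) (at_right 0)" by real_asymp
  moreover have "filterlim u (at_right 0) sequentially"
    using assms(1,2) by (auto simp: filterlim_at elim: eventually_mono)
  ultimately have "(\<lambda>n. ln (1 - u n) / u n) \<longlonglongrightarrow> - 1" by (rule filterlim_compose)
  from tendsto_mult[OF assms(3) this]
  have lim: "(\<lambda>n. exp (real (k n) * u n * (ln (1 - u n) / u n))) \<longlonglongrightarrow> exp (- K)"
    by (intro tendsto_exp) simp
  have "eventually (\<lambda>n. u n < 1) sequentially" using order_tendstoD(2)[OF assms(1)] by simp
  with assms(2) have "eventually (\<lambda>n. exp (real (k n) * u n * (ln (1 - u n) / u n)) = (1 - u n) ^ k n) sequentially"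
    by eventually_elim (simp add: exp_of_nat_mult)
  with lim show ?thesis by (rule Lim_transform_eventually)
qed

text \<open>Up to sign the ratio is the generalised binomial coefficient of -1/2, whose asymptotics
  bring in Gamma (1/2) = sqrt pi. This takes the place of Stirling's formula.\<close>

lemma central_binomial_asymptotic:
  "(\<lambda>n. sqrt (pi * n) * central_binomial_ratio n 0) \<longlonglongrightarrow> 1"
proof -
  have gb: "(- 1 / 2 :: real) gchoose n = (- 1) ^ n * central_binomial_ratio n 0" for n
  proof (induction n)
    case 0
    show ?case by (simp add: central_binomial_ratio_def)
  next
    case (Suc n)
    have cb: "real (2 * k choose k) = fact (2 * k) / (fact k)\<^sup>2" for k
      by (simp add: binomial_fact power2_eq_square mult_2)
    have f: "fact (2 * Suc n) = (2 * real n + 2) * (2 * real n + 1) * fact (2 * n)"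
      by (simp add: algebra_simps)
    have "A * G / (N * F)\<^sup>2 = A / N\<^sup>2 * (G / F\<^sup>2)" for A G N F :: real
      by (simp add: power_mult_distrib)
    then have "real (2 * Suc n choose Suc n) =
        (2 * real n + 2) * (2 * real n + 1) / (real (Suc n))\<^sup>2 * real (2 * n choose n)"
      unfolding cb f by (simp only: fact_Suc of_nat_mult of_nat_fact)
    also have "(2 * real n + 2) * (2 * real n + 1) / (real (Suc n))\<^sup>2 = 2 * (2 * real n + 1) / (real n + 1)"
      by (simp add: power2_eq_square divide_simps) (simp add: algebra_simps)
    finally have "real (2 * Suc n choose Suc n) = 2 * (2 * real n + 1) / (real n + 1) * real (2 * n choose n)" .
    moreover have "2 * A / N * C / (4 * P) = A / (2 * N) * (C / P)" for A N C P :: real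
      by simp
    ultimately have "central_binomial_ratio (Suc n) 0 = (2 * real n + 1) / (2 * (real n + 1)) * central_binomial_ratio n 0"
      by (simp only: central_binomial_ratio_def add_0_right power_Suc)
    moreover have "(- 1 / 2 :: real) gchoose Suc n = (- 1 / 2 gchoose n) * ((- 1 / 2 - real n) / (real n + 1))"
      by (simp add: gbinomial_prod_rev atLeast0_lessThan_Suc field_simps)
    moreover have "(- 1 / 2 - real n) / (real n + 1) = - ((2 * real n + 1) / (2 * (real n + 1)))"
      by (simp add: divide_simps)
    ultimately show ?case by (simp only: Suc.IH power_Suc) simp
  qed
  have "(\<lambda>n. ((- 1 / 2 :: real) gchoose n) / ((- 1) ^ n / exp ((- 1 / 2 + 1) * ln (real n)))) \<longlonglongrightarrow> inverse (Gamma (- (- 1 / 2)))"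
    using gbinomial_asymptotic[of "- 1 / 2 :: real"] by simp
  then have "(\<lambda>n. sqrt pi * (((- 1 / 2 :: real) gchoose n) / ((- 1) ^ n / exp ((- 1 / 2 + 1) * ln (real n))))) \<longlonglongrightarrow> sqrt pi * inverse (Gamma (1 / 2))"
    by (intro tendsto_mult) simp_all
  moreover have "sqrt pi * inverse (Gamma (1 / 2 :: real)) = 1" by (simp add: Gamma_one_half_real)
  moreover have "eventually (\<lambda>n. sqrt pi * (((- 1 / 2 :: real) gchoose n) / ((- 1) ^ n / exp ((- 1 / 2 + 1) * ln (real n)))) =
      sqrt (pi * n) * central_binomial_ratio n 0) sequentially"
    using eventually_gt_at_top[of 0]
  proof eventually_elim
    case (elim n)
    have "exp ((- 1 / 2 + 1) * ln (real n)) = sqrt n"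
      using elim by (simp add: powr_def flip: powr_half_sqrt)
    then show ?case by (simp only: gb) (simp add: real_sqrt_mult)
  qed
  ultimately show ?thesis by (simp add: Lim_transform_eventually)
qed

text \<open>The quotient of the two binomial coefficients is (m!)^2 / ((m - d)! (m + d)!). The d
  factors by which each of these factorials differs from m! are paired off.\<close>

lemma central_binomial_ratio_conv_prod:
  assumes "d \<le> m"
  shows "central_binomial_ratio m d =
    central_binomial_ratio m 0 * (\<Prod>i<d. 1 - real d / (real m + 1 + real i))"
proof -
  have fact_add: "fact (n + d) = fact n * (\<Prod>i<d. real n + 1 + real i)" for n d
    by (induction d) (simp_all add: algebra_simps)
  have nz: "(\<Prod>i<d. real m + 1 + real i) \<noteq> 0" by (simp add: add_nonneg_eq_0_iff)
  have top: "fact m = fact (m - d) * (\<Prod>i<d. real m + 1 + real i - real d)"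
    using fact_add[of "m - d" d] assms by (simp add: of_nat_diff algebra_simps)
  have "(\<Prod>i<d. 1 - real d / (real m + 1 + real i)) =
      (\<Prod>i<d. (real m + 1 + real i - real d) / (real m + 1 + real i))"
    by (intro prod.cong) (auto simp: field_simps)
  also have "\<dots> = (\<Prod>i<d. real m + 1 + real i - real d) / (\<Prod>i<d. real m + 1 + real i)"
    by (rule prod_dividef)
  also have "\<dots> = (fact m * fact m) / (fact (m - d) * fact (m + d))"
    unfolding fact_add[of m] using top nz by (simp add: field_simps)
  finally have *: "(\<Prod>i<d. 1 - real d / (real m + 1 + real i)) = (fact m * fact m) / (fact (m - d) * fact (m + d))" .
  have "real (2 * m choose (m + d)) = fact (2 * m) / (fact (m + d) * fact (m - d))"
    using assms by (subst binomial_fact) (auto simp: mult_2)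
  moreover have "real (2 * m choose m) = fact (2 * m) / (fact m * fact m)"
    by (subst binomial_fact) (auto simp: mult_2)
  ultimately show ?thesis unfolding * central_binomial_ratio_def by (simp add: field_simps)
qed

lemma central_binomial_ratio_nonneg: "central_binomial_ratio m d \<ge> 0"
  by (simp add: central_binomial_ratio_def)

text \<open>The factors of the product increase with i from i = 0 to i = d - 1. Replacing all of
  them by one extreme leaves a pure power, fit for \<open>tendsto_one_minus_power\<close>.\<close>

lemma central_binomial_ratio_bounds:
  assumes "d \<le> m"
  shows "central_binomial_ratio m 0 * (1 - real d / (real m + 1)) ^ d \<le> central_binomial_ratio m d"
    and "d > 0 \<Longrightarrow> central_binomial_ratio m d \<le> central_binomial_ratio m 0 * (1 - real d / (real m + real d)) ^ d"
proof -
  have "(\<Prod>i<d. 1 - real d / (real m + 1)) \<le> (\<Prod>i<d. 1 - real d / (real m + 1 + real i))"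
    using assms by (intro prod_mono) (auto simp: field_simps)
  then show "central_binomial_ratio m 0 * (1 - real d / (real m + 1)) ^ d \<le> central_binomial_ratio m d"
    unfolding central_binomial_ratio_conv_prod[OF assms]
    by (intro mult_left_mono central_binomial_ratio_nonneg) simp
  assume "d > 0"
  have "(\<Prod>i<d. 1 - real d / (real m + 1 + real i)) \<le> (\<Prod>i<d. 1 - real d / (real m + real d))"
  proof (intro prod_mono conjI)
    fix i assume "i \<in> {..<d}"
    then have "real i + 1 \<le> real d" by simp
    then show "1 - real d / (real m + 1 + real i) \<le> 1 - real d / (real m + real d)"
      by (intro diff_left_mono divide_left_mono) auto
    show "0 \<le> 1 - real d / (real m + 1 + real i)" using assms by (simp add: field_simps)
  qed
  then show "central_binomial_ratio m d \<le> central_binomial_ratio m 0 * (1 - real d / (real m + real d)) ^ d"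
    unfolding central_binomial_ratio_conv_prod[OF assms]
    by (intro mult_left_mono central_binomial_ratio_nonneg) simp
qed

text \<open>A Gaussian majorant for Tannery's theorem. Replacing m + d by 2 m halves the limiting
  exponent d^2 / m, which a majorant can afford; 1 - v \<le> exp (- v) does the rest.\<close>

lemma central_binomial_ratio_le_exp:
  assumes "m > 0"
  shows "central_binomial_ratio m d \<le> central_binomial_ratio m 0 * exp (- ((real d)\<^sup>2 / (2 * m)))"
proof (cases "0 < d \<and> d \<le> m")
  case True
  have "(1 - real d / (real m + real d)) ^ d \<le> exp (- (real d / (2 * m))) ^ d"
  proof (rule power_mono)
    have "1 - real d / (real m + real d) \<le> 1 - real d / (2 * m)"
      using True by (intro diff_left_mono divide_left_mono) auto
    also have "\<dots> \<le> exp (- (real d / (2 * m)))"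
      using exp_ge_add_one_self[of "- (real d / (2 * m))"] by simp
    finally show "1 - real d / (real m + real d) \<le> exp (- (real d / (2 * m)))" .
    show "0 \<le> 1 - real d / (real m + real d)" using True by (simp add: field_simps)
  qed
  also have "\<dots> = exp (- ((real d)\<^sup>2 / (2 * m)))"
    by (simp add: power2_eq_square flip: exp_of_nat_mult)
  finally show ?thesis
    using central_binomial_ratio_bounds(2)[of d m] True
    by (auto intro: order_trans[OF _ mult_left_mono] central_binomial_ratio_nonneg)
next
  case False
  then show ?thesis
    by (auto simp: central_binomial_ratio_nonneg central_binomial_ratio_eq_0 not_le)
qed

text \<open>The derivative of exp (x^2 / 2) cos x has the sign of x cos x - sin x, which is never
  positive on [0, pi/2].\<close>

lemma cos_le_exp:
  assumes "0 \<le> x" "x \<le> pi / 2"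
  shows "cos x \<le> exp (- (x\<^sup>2 / 2))"
proof -
  have aux: "v * cos v \<le> sin v" if "0 \<le> v" "v \<le> pi / 2" for v
  proof -
    have "sin 0 - 0 * cos 0 \<le> sin v - v * cos v"
    proof (rule DERIV_nonneg_imp_nondecreasing[OF that(1)])
      fix w assume "0 \<le> w" "w \<le> v"
      then show "\<exists>D. ((\<lambda>v. sin v - v * cos v) has_real_derivative D) (at w) \<and> 0 \<le> D"
        using that by (intro exI[of _ "w * sin w"]) (auto intro!: derivative_eq_intros mult_nonneg_nonneg sin_ge_zero)
    qed
    then show ?thesis by simp
  qed
  have "exp (x\<^sup>2 / 2) * cos x \<le> exp (0\<^sup>2 / 2) * cos 0"
  proof (rule DERIV_nonpos_imp_nonincreasing[OF assms(1)])
    fix v assume v: "0 \<le> v" "v \<le> x"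
    show "\<exists>D. ((\<lambda>x. exp (x\<^sup>2 / 2) * cos x) has_real_derivative D) (at v) \<and> D \<le> 0"
    proof (intro exI conjI)
      show "((\<lambda>x. exp (x\<^sup>2 / 2) * cos x) has_real_derivative exp (v\<^sup>2 / 2) * (v * cos v - sin v)) (at v)"
        by (auto intro!: derivative_eq_intros simp: algebra_simps)
      show "exp (v\<^sup>2 / 2) * (v * cos v - sin v) \<le> 0"
        using aux[of v] v assms by (intro mult_nonneg_nonpos) auto
    qed
  qed
  then show ?thesis by (simp add: exp_minus field_simps)
qed

lemma summable_exp_minus_mult_of_nat:
  assumes "A > 0"
  shows "summable (\<lambda>k. exp (- (A * real k)))"
proof -
  have "exp (- (A * real k)) = exp (- A) ^ k" for k by (simp add: mult.commute flip: exp_of_nat_mult)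
  then show ?thesis using assms by (simp add: summable_geometric)
qed

lemma eta_series_summable:
  assumes "y > 0" "a > 0"
  shows "summable (\<lambda>k. exp (- (pi * y * (6 * real k + a)\<^sup>2 / 12)))"
proof (rule summable_comparison_test'[OF summable_exp_minus_mult_of_nat])
  show "pi * y * a > 0" using assms by simp
  fix k :: nat
  have "12 * a * real k \<le> (6 * real k + a)\<^sup>2" by (simp add: power2_sum)
  from mult_left_mono[OF this, of "pi * y"] show "norm (exp (- (pi * y * (6 * real k + a)\<^sup>2 / 12))) \<le> exp (- (pi * y * a * real k))"
    using assms by (simp add: field_simps)
qed

text \<open>A local central limit theorem at d = a r with m near c r^2: d^2 / m tends to a^2 / c in
  both power bounds, and the central coefficient is asymptotic to 1 / sqrt (pi m).\<close>

lemma tendsto_central_binomial_ratio: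
  fixes m :: "nat \<Rightarrow> nat"
  assumes "c > 0" "(\<lambda>r. real (m r) / (real r)\<^sup>2) \<longlonglongrightarrow> c" "filterlim m at_top sequentially" "a > 0"
  shows "(\<lambda>r. sqrt (pi * m r) * central_binomial_ratio (m r) (a * r)) \<longlonglongrightarrow> exp (- ((real a)\<^sup>2 / c))"
proof (rule tendsto_sandwich)
  have pos: "eventually (\<lambda>r::nat. r > 0) sequentially" by (rule eventually_gt_at_top)
  have lim0: "(\<lambda>r. sqrt (pi * m r) * central_binomial_ratio (m r) 0) \<longlonglongrightarrow> 1"
    using filterlim_compose[OF central_binomial_asymptotic assms(3)] .
  have le: "eventually (\<lambda>r. a * r \<le> m r) sequentially"
  proof -
    have "(\<lambda>r. real (m r) / (real r)\<^sup>2 - real a / real r) \<longlonglongrightarrow> c - 0"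
      by (intro tendsto_diff assms) real_asymp
    from order_tendstoD(1)[OF this, of 0] assms(1)
    have "eventually (\<lambda>r. 0 < real (m r) / (real r)\<^sup>2 - real a / real r) sequentially" by simp
    with pos show ?thesis
    proof eventually_elim
      case (elim r)
      then have "real (a * r) < real (m r)" by (simp add: field_simps power2_eq_square)
      then show ?case by (simp only: of_nat_less_iff less_imp_le)
    qed
  qed
  have lower: "(\<lambda>r. (1 - real (a * r) / (real (m r) + 1)) ^ (a * r)) \<longlonglongrightarrow> exp (- ((real a)\<^sup>2 / c))"
    and upper: "(\<lambda>r. (1 - real (a * r) / (real (m r) + real (a * r))) ^ (a * r)) \<longlonglongrightarrow> exp (- ((real a)\<^sup>2 / c))"
  proof -
    \<comment> \<open>Both bounds at once: \<open>e r\<close> is 1 or a r, in either case negligible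
      against r^2.\<close>
    have gen: "(\<lambda>r. (1 - real (a * r) / (real (m r) + e r)) ^ (a * r)) \<longlonglongrightarrow> exp (- ((real a)\<^sup>2 / c))"
      if e: "(\<lambda>r. e r / (real r)\<^sup>2) \<longlonglongrightarrow> 0" "\<And>r. r > 0 \<Longrightarrow> e r > 0" for e
    proof (rule tendsto_one_minus_power)
      have 1: "(\<lambda>r. real (m r) / (real r)\<^sup>2 + e r / (real r)\<^sup>2) \<longlonglongrightarrow> c + 0"
        by (intro tendsto_add assms e)
      have "(\<lambda>r. (real a)\<^sup>2 / (real (m r) / (real r)\<^sup>2 + e r / (real r)\<^sup>2)) \<longlonglongrightarrow> (real a)\<^sup>2 / (c + 0)"
        using assms(1) by (intro tendsto_divide tendsto_const 1) auto
      moreover have "eventually (\<lambda>r. (real a)\<^sup>2 / (real (m r) / (real r)\<^sup>2 + e r / (real r)\<^sup>2)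
          = real (a * r) * (real (a * r) / (real (m r) + e r))) sequentially"
        using pos
      proof eventually_elim
        case (elim r)
        then show ?case using e(2)[OF elim]
          by (simp add: power2_eq_square flip: add_divide_distrib)
      qed
      ultimately show "(\<lambda>r. real (a * r) * (real (a * r) / (real (m r) + e r))) \<longlonglongrightarrow> (real a)\<^sup>2 / c"
        by (simp add: Lim_transform_eventually)
      have "(\<lambda>r. (real a / real r) / (real (m r) / (real r)\<^sup>2 + e r / (real r)\<^sup>2)) \<longlonglongrightarrow> 0 / (c + 0)"
        using assms(1) by (intro tendsto_divide 1; real_asymp?) auto
      moreover have "eventually (\<lambda>r. (real a / real r) / (real (m r) / (real r)\<^sup>2 + e r / (real r)\<^sup>2)
          = real (a * r) / (real (m r) + e r)) sequentially"
        using pos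
      proof eventually_elim
        case (elim r)
        then show ?case using e(2)[OF elim]
          by (simp add: power2_eq_square flip: add_divide_distrib)
      qed
      ultimately show "(\<lambda>r. real (a * r) / (real (m r) + e r)) \<longlonglongrightarrow> 0"
        by (simp add: Lim_transform_eventually)
      show "eventually (\<lambda>r. 0 < real (a * r) / (real (m r) + e r)) sequentially"
        using pos by eventually_elim (use assms(4) e(2) in \<open>auto intro!: divide_pos_pos add_nonneg_pos\<close>)
    qed
    show "(\<lambda>r. (1 - real (a * r) / (real (m r) + 1)) ^ (a * r)) \<longlonglongrightarrow> exp (- ((real a)\<^sup>2 / c))"
      by (rule gen) (real_asymp, simp)
    show "(\<lambda>r. (1 - real (a * r) / (real (m r) + real (a * r))) ^ (a * r)) \<longlonglongrightarrow> exp (- ((real a)\<^sup>2 / c))"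
      by (rule gen) (simp, real_asymp, use assms(4) in simp)
  qed
  show "(\<lambda>r. sqrt (pi * m r) * central_binomial_ratio (m r) 0 * (1 - real (a * r) / (real (m r) + 1)) ^ (a * r))
      \<longlonglongrightarrow> exp (- ((real a)\<^sup>2 / c))"
    using tendsto_mult[OF lim0 lower] by simp
  show "(\<lambda>r. sqrt (pi * m r) * central_binomial_ratio (m r) 0 * (1 - real (a * r) / (real (m r) + real (a * r))) ^ (a * r))
      \<longlonglongrightarrow> exp (- ((real a)\<^sup>2 / c))"
    using tendsto_mult[OF lim0 upper] by simp
  show "eventually (\<lambda>r. sqrt (pi * m r) * central_binomial_ratio (m r) 0 * (1 - real (a * r) / (real (m r) + 1)) ^ (a * r)
      \<le> sqrt (pi * m r) * central_binomial_ratio (m r) (a * r)) sequentially"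
    using le by eventually_elim
      (simp only: mult.assoc, intro mult_left_mono central_binomial_ratio_bounds(1), auto)
  show "eventually (\<lambda>r. sqrt (pi * m r) * central_binomial_ratio (m r) (a * r)
      \<le> sqrt (pi * m r) * central_binomial_ratio (m r) 0 * (1 - real (a * r) / (real (m r) + real (a * r))) ^ (a * r)) sequentially"
    using le pos by eventually_elim
      (simp only: mult.assoc, intro mult_left_mono central_binomial_ratio_bounds(2), use assms(4) in auto)
qed

lemma tendsto_cos_power:
  fixes m :: "nat \<Rightarrow> nat"
  assumes "(\<lambda>r. real (m r) / (real r)\<^sup>2) \<longlonglongrightarrow> c" "b > 0"
  shows "(\<lambda>r. cos (b / real r) ^ (2 * m r)) \<longlonglongrightarrow> exp (- (c * b\<^sup>2))"
proof -
  have "(\<lambda>r. (1 - (1 - cos (b / real r))) ^ (2 * m r)) \<longlonglongrightarrow> exp (- (c * b\<^sup>2))"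
  proof (rule tendsto_one_minus_power)
    show "(\<lambda>r. 1 - cos (b / real r)) \<longlonglongrightarrow> 0" using assms(2) by real_asymp
    show "eventually (\<lambda>r. 0 < 1 - cos (b / real r)) sequentially" using assms(2) by real_asymp
    have "(\<lambda>r. (real r)\<^sup>2 * (1 - cos (b / real r))) \<longlonglongrightarrow> b * b / 2"
      using assms(2) by real_asymp
    from tendsto_mult[OF tendsto_mult[OF tendsto_const[of 2] assms(1)] this]
    have "(\<lambda>r. 2 * (real (m r) / (real r)\<^sup>2) * ((real r)\<^sup>2 * (1 - cos (b / real r)))) \<longlonglongrightarrow> c * b\<^sup>2"
      by (simp add: power2_eq_square)
    moreover have "eventually (\<lambda>r. 2 * (real (m r) / (real r)\<^sup>2) * ((real r)\<^sup>2 * (1 - cos (b / real r)))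
        = real (2 * m r) * (1 - cos (b / real r))) sequentially"
      using eventually_gt_at_top[of 0] by eventually_elim simp
    ultimately show "(\<lambda>r. real (2 * m r) * (1 - cos (b / real r))) \<longlonglongrightarrow> c * b\<^sup>2"
      by (rule Lim_transform_eventually)
  qed
  then show ?thesis by simp
qed

text \<open>Group the series in threes. At 2 j + 1 = 6 k + 1, 6 k + 3, 6 k + 5 the cosine is (-1)^k
  times sqrt 3 / 2, 0, - sqrt 3 / 2, which reproduces the paired terms of
  \<open>eta_series\<close>.\<close>

lemma cos_series_eq_eta:
  assumes "y > 0"
    and sm: "summable (\<lambda>j. exp (- (pi * y * (2 * real j + 1)\<^sup>2 / 12)) * cos (pi * (2 * real j + 1) / 6))"
  shows "(\<Sum>j. exp (- (pi * y * (2 * real j + 1)\<^sup>2 / 12)) * cos (pi * (2 * real j + 1) / 6)) =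
    sqrt 3 / 2 * eta_series y"
proof -
  define f where "f j = exp (- (pi * y * (2 * real j + 1)\<^sup>2 / 12)) * cos (pi * (2 * real j + 1) / 6)" for j :: nat
  define g where "g k = (- 1) ^ k * (exp (- (pi * y * (6 * real k + 1)\<^sup>2 / 12))
                                   - exp (- (pi * y * (6 * real k + 5)\<^sup>2 / 12)))" for k :: nat
  have c0: "cos (pi * (2 * real (3 * k) + 1) / 6) = (- 1) ^ k * (sqrt 3 / 2)" for k
  proof -
    have "pi * (2 * real (3 * k) + 1) / 6 = pi * real k + pi / 6" by (simp add: field_simps)
    then show ?thesis by (simp only: cos_add) (simp add: cos_30)
  qed
  have c1: "cos (pi * (2 * real (3 * k + 1) + 1) / 6) = 0" for k
  proof -
    have "pi * (2 * real (3 * k + 1) + 1) / 6 = pi * real k + pi / 2" by (simp add: field_simps)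
    then show ?thesis by (simp only: cos_add) simp
  qed
  have c2: "cos (pi * (2 * real (3 * k + 2) + 1) / 6) = - ((- 1) ^ k * (sqrt 3 / 2))" for k
  proof -
    have "pi * (2 * real (3 * k + 2) + 1) / 6 = pi * real (Suc k) - pi / 6" by (simp add: field_simps)
    then show ?thesis by (simp only: cos_diff cos_npi2 sin_npi2) (simp add: cos_30)
  qed
  have "sum f {k * 3..<k * 3 + 3} = sqrt 3 / 2 * g k" for k
  proof -
    have "{k * 3..<k * 3 + 3} = {3 * k, 3 * k + 1, 3 * k + 2}" by auto
    then have "sum f {k * 3..<k * 3 + 3} = f (3 * k) + f (3 * k + 1) + f (3 * k + 2)" by simp
    also have "\<dots> = sqrt 3 / 2 * g k"
      unfolding f_def c0 c1 c2 by (simp add: g_def algebra_simps)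
    finally show ?thesis .
  qed
  moreover have "(\<lambda>k. sum f {k * 3..<k * 3 + 3}) sums suminf f"
    by (rule sums_group[OF summable_sums[OF sm[folded f_def]]]) simp
  ultimately have "(\<lambda>k. sqrt 3 / 2 * g k) sums suminf f" by (simp only:)
  moreover have "summable g"
  proof (rule summable_comparison_test'[OF summable_add[OF eta_series_summable[OF assms(1), of 1]
          eta_series_summable[OF assms(1), of 5]]])
    have "\<bar>(- 1) ^ k * (a - b)\<bar> \<le> a + b" if "a \<ge> 0" "b \<ge> 0" for a b :: real and k :: nat
      using that by (simp add: abs_mult)
    then show "norm (g k) \<le> exp (- (pi * y * (6 * real k + 1)\<^sup>2 / 12)) + exp (- (pi * y * (6 * real k + 5)\<^sup>2 / 12))"
      for k by (simp add: g_def)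
  qed auto
  then have "(\<lambda>k. sqrt 3 / 2 * g k) sums (sqrt 3 / 2 * suminf g)"
    by (intro sums_mult summable_sums)
  ultimately have "suminf f = sqrt 3 / 2 * suminf g" by (rule sums_unique2)
  then show ?thesis unfolding eta_series_def f_def[symmetric] g_def[symmetric] .
qed

text \<open>Let r tend to infinity in Polya's identity with m close to c r^2. The binomial side,
  scaled by sqrt (pi m), becomes \<open>eta_series y\<close>; the cosine side becomes a multiple of
  \<open>eta_series (1 / y)\<close>. Tannery's theorem justifies both limits.\<close>

theorem eta_series_transformation:
  assumes "y > 0"
  shows "eta_series (1 / y) = sqrt y * eta_series y"
proof -
  \<comment> \<open>This value makes x^2 / c equal to pi y x^2 / 12 on the binomial side and c (pi n
    / 12)^2 equal to pi n^2 / (12 y) on the cosine side.\<close>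
  define c where "c = 12 / (pi * y)"
  define m where "m r = nat \<lfloor>c * (real r)\<^sup>2\<rfloor>" for r :: nat
  define b where "b = central_binomial_ratio"
  have c: "c > 0" using assms by (simp add: c_def)
  have m_le: "real (m r) \<le> c * (real r)\<^sup>2" for r
    using c by (simp add: m_def)
  have m_gt: "real (m r) > c * (real r)\<^sup>2 - 1" for r
    using c by (simp add: m_def)
  have pos: "eventually (\<lambda>r::nat. r > 0) sequentially" by (rule eventually_gt_at_top)
  have m_lim: "(\<lambda>r. real (m r) / (real r)\<^sup>2) \<longlonglongrightarrow> c"
  proof (rule tendsto_sandwich[of "\<lambda>r. c - 1 / (real r)\<^sup>2" _ _ "\<lambda>r. c"])
    show "(\<lambda>r. c - 1 / (real r)\<^sup>2) \<longlonglongrightarrow> c" by real_asymp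
    show "eventually (\<lambda>r. c - 1 / (real r)\<^sup>2 \<le> real (m r) / (real r)\<^sup>2) sequentially"
      using pos
    proof eventually_elim
      case (elim r)
      have "c - 1 / (real r)\<^sup>2 = (c * (real r)\<^sup>2 - 1) / (real r)\<^sup>2"
        using elim by (simp add: diff_divide_distrib)
      also have "\<dots> \<le> real (m r) / (real r)\<^sup>2"
        using m_gt[of r] by (intro divide_right_mono) auto
      finally show ?case .
    qed
    show "eventually (\<lambda>r. real (m r) / (real r)\<^sup>2 \<le> c) sequentially"
      using pos by eventually_elim (use m_le in \<open>simp add: field_simps\<close>)
  qed simp
  have m_top: "filterlim m at_top sequentially"
  proof -
    have "filterlim (\<lambda>r. c * (real r)\<^sup>2 - 1) at_top sequentially" using c by real_asymp
    then have "filterlim (\<lambda>r. real (m r)) at_top sequentially"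
      by (rule filterlim_at_top_mono) (use m_gt in \<open>auto intro!: always_eventually less_imp_le\<close>)
    then show ?thesis by (simp add: filterlim_sequentially_iff_filterlim_real)
  qed
  have m_half: "eventually (\<lambda>r. c / 2 * (real r)\<^sup>2 \<le> real (m r)) sequentially"
  proof -
    have "eventually (\<lambda>r. c / 2 < real (m r) / (real r)\<^sup>2) sequentially"
      using order_tendstoD(1)[OF m_lim, of "c / 2"] c by simp
    with pos show ?thesis by eventually_elim (simp add: field_simps)
  qed
  have m_pos: "eventually (\<lambda>r. m r > 0) sequentially"
    by (rule eventually_compose_filterlim[OF eventually_gt_at_top m_top])

  have exp_c: "exp (- (x\<^sup>2 / c)) = exp (- (pi * y * x\<^sup>2 / 12))" for x :: real
    by (simp add: c_def mult_ac)
  obtain B where B: "sqrt (pi * n) * b n 0 \<le> B" for n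
  proof -
    from central_binomial_asymptotic have "Bseq (\<lambda>n. sqrt (pi * real n) * central_binomial_ratio n 0)"
      by (intro convergent_imp_Bseq) (auto simp: convergent_def)
    then obtain B where "\<forall>n. norm (sqrt (pi * real n) * central_binomial_ratio n 0) \<le> B"
      by (auto elim: BseqE)
    then show ?thesis by (intro that[of B]) (auto simp: b_def intro: order_trans[OF abs_ge_self])
  qed
  \<comment> \<open>The halved exponent of \<open>central_binomial_ratio_le_exp\<close> shows up as
    \<open>y / 2\<close>. The majorant does not depend on r.\<close>
  have b_bound: "norm (sqrt (pi * m r) * b (m r) ((6 * k + a) * r)) \<le> B * exp (- (pi * (y / 2) * (6 * real k + a)\<^sup>2 / 12))"
    if "m r > 0" "r > 0" for r k a
  proof -
    have "(6 * real k + a)\<^sup>2 / (2 * c) \<le> (real ((6 * k + a) * r))\<^sup>2 / (2 * m r)"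
    proof -
      have "(6 * real k + a)\<^sup>2 / (2 * c) = (real ((6 * k + a) * r))\<^sup>2 / (2 * (c * (real r)\<^sup>2))"
        using that by (simp add: power_mult_distrib)
      also have "\<dots> \<le> (real ((6 * k + a) * r))\<^sup>2 / (2 * m r)"
        using m_le[of r] that c by (intro divide_left_mono) auto
      finally show ?thesis .
    qed
    then have e: "exp (- ((real ((6 * k + a) * r))\<^sup>2 / (2 * m r))) \<le> exp (- (pi * (y / 2) * (6 * real k + a)\<^sup>2 / 12))"
      by (simp add: c_def mult_ac)
    have "sqrt (pi * m r) * b (m r) ((6 * k + a) * r) \<le>
        sqrt (pi * m r) * (b (m r) 0 * exp (- ((real ((6 * k + a) * r))\<^sup>2 / (2 * m r))))"
      unfolding b_def by (intro mult_left_mono central_binomial_ratio_le_exp that) simp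
    also have "\<dots> = sqrt (pi * m r) * b (m r) 0 * exp (- ((real ((6 * k + a) * r))\<^sup>2 / (2 * m r)))"
      by simp
    also have "\<dots> \<le> B * exp (- (pi * (y / 2) * (6 * real k + a)\<^sup>2 / 12))"
      by (intro mult_mono B e order_trans[OF _ B])
         (auto simp: b_def intro!: mult_nonneg_nonneg central_binomial_ratio_nonneg)
    finally show ?thesis by (simp add: b_def central_binomial_ratio_nonneg abs_mult)
  qed
  define p where "p k r = (- 1) ^ k * (sqrt (pi * m r) * b (m r) ((6 * k + 1) * r)
      - sqrt (pi * m r) * b (m r) ((6 * k + 5) * r))" for k r :: nat
  define M where "M k = B * exp (- (pi * (y / 2) * (6 * real k + 1)\<^sup>2 / 12))
      + B * exp (- (pi * (y / 2) * (6 * real k + 5)\<^sup>2 / 12))" for k :: nat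
  have p_lim: "(\<lambda>r. \<Sum>k. p k r) \<longlonglongrightarrow> eta_series y"
    unfolding eta_series_def
  proof (rule tannery_uniform(2))
    fix k :: nat
    have "(\<lambda>r. p k r) \<longlonglongrightarrow> (- 1) ^ k * (exp (- ((real (6 * k + 1))\<^sup>2 / c)) - exp (- ((real (6 * k + 5))\<^sup>2 / c)))"
      unfolding p_def b_def
      by (intro tendsto_mult tendsto_const tendsto_diff tendsto_central_binomial_ratio c m_lim m_top) auto
    then show "(\<lambda>r. p k r) \<longlonglongrightarrow> (- 1) ^ k * (exp (- (pi * y * (6 * real k + 1)\<^sup>2 / 12))
                                   - exp (- (pi * y * (6 * real k + 5)\<^sup>2 / 12)))"
      unfolding exp_c of_nat_add of_nat_mult of_nat_numeral of_nat_1 .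
  next
    show "summable M"
      unfolding M_def using assms by (intro summable_add summable_mult eta_series_summable) auto
    show "eventually (\<lambda>r. \<forall>k. norm (p k r) \<le> M k) sequentially"
      using m_pos pos
    proof eventually_elim
      case (elim r)
      show ?case
      proof
        fix k
        show "norm (p k r) \<le> M k"
          unfolding p_def M_def norm_mult norm_power norm_minus_cancel norm_one power_one mult_1
          using add_mono[OF b_bound[OF elim, of k 1] b_bound[OF elim, of k 5]]
          by (intro order_trans[OF norm_triangle_ineq4]) simp
      qed
    qed
  qed
  \<comment> \<open>Extension by zero turns a sum whose range grows with r into a series, so that
    Tannery's theorem applies.\<close>
  define q where "q j r = (if j < 3 * r then
      cos (pi * (2 * real j + 1) / (12 * r)) ^ (2 * m r) * cos (pi * (2 * real j + 1) / 6) else 0)" for j r :: nat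
  define s where "s j = exp (- (pi * (1 / y) * (2 * real j + 1)\<^sup>2 / 12)) * cos (pi * (2 * real j + 1) / 6)" for j :: nat
  have c_sq: "c * (pi * (2 * real j + 1) / 12)\<^sup>2 = pi * (1 / y) * (2 * real j + 1)\<^sup>2 / 12" for j :: nat
    by (simp add: c_def power2_eq_square)
  have tan1: "(\<lambda>r. q j r) \<longlonglongrightarrow> s j" for j
  proof -
    have "(\<lambda>r. cos (pi * (2 * real j + 1) / 12 / real r) ^ (2 * m r)) \<longlonglongrightarrow> exp (- (c * (pi * (2 * real j + 1) / 12)\<^sup>2))"
      by (intro tendsto_cos_power m_lim) (simp add: add_nonneg_pos)
    then have "(\<lambda>r. cos (pi * (2 * real j + 1) / 12 / real r) ^ (2 * m r) * cos (pi * (2 * real j + 1) / 6)) \<longlonglongrightarrow> s j"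
      unfolding c_sq s_def by (intro tendsto_mult tendsto_const)
    moreover have "eventually (\<lambda>r. cos (pi * (2 * real j + 1) / 12 / real r) ^ (2 * m r) * cos (pi * (2 * real j + 1) / 6) = q j r) sequentially"
      using eventually_gt_at_top[of j] by eventually_elim (simp add: q_def)
    ultimately show ?thesis by (rule Lim_transform_eventually)
  qed
  \<comment> \<open>On the half range \<open>cos_le_exp\<close> bounds the power by exp (- m
    \<theta>^2). With m at least c r^2 / 2 the dependence on r cancels, and (2 j + 1)^2 \<ge> j
    leaves a geometric majorant.\<close>
  have tan2: "eventually (\<lambda>r. \<forall>j. norm (q j r) \<le> exp (- (pi * (1 / y) / 24 * real j))) sequentially"
    using m_half pos
  proof eventually_elim
    case (elim r)
    show ?case
    proof
      fix j
      show "norm (q j r) \<le> exp (- (pi * (1 / y) / 24 * real j))"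
      proof (cases "j < 3 * r")
        case True
        define \<theta> where "\<theta> = pi * (2 * real j + 1) / (12 * r)"
        have "2 * real j + 1 \<le> 6 * real r" using True by linarith
        from mult_left_mono[OF this, of pi] have \<theta>: "0 \<le> \<theta>" "\<theta> \<le> pi / 2"
          using elim by (simp_all add: \<theta>_def field_simps)
        have "norm (cos \<theta> ^ (2 * m r)) = cos \<theta> ^ (2 * m r)" using \<theta> by (simp add: cos_ge_zero)
        also have "\<dots> \<le> exp (- (\<theta>\<^sup>2 / 2)) ^ (2 * m r)"
          using \<theta> by (intro power_mono cos_le_exp cos_ge_zero) auto
        also have "\<dots> = exp (- (m r * \<theta>\<^sup>2))" by (simp flip: exp_of_nat_mult)
        also have "\<dots> \<le> exp (- (pi * (1 / y) / 24 * real j))"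
        proof -
          have "pi * (1 / y) / 24 * real j \<le> pi * (1 / y) / 24 * (2 * real j + 1)\<^sup>2"
            using assms by (intro mult_left_mono) (auto simp: power2_sum)
          also have "\<dots> = c / 2 * (real r)\<^sup>2 * \<theta>\<^sup>2"
            using elim assms by (simp add: c_def \<theta>_def power2_eq_square)
          also have "\<dots> \<le> m r * \<theta>\<^sup>2" by (intro mult_right_mono elim) simp
          finally show ?thesis by simp
        qed
        finally have "norm (cos \<theta> ^ (2 * m r)) \<le> exp (- (pi * (1 / y) / 24 * real j))" .
        then have "norm (cos \<theta> ^ (2 * m r)) * norm (cos (pi * (2 * real j + 1) / 6)) \<le> exp (- (pi * (1 / y) / 24 * real j)) * 1"
          by (intro mult_mono) auto
        then show ?thesis using True by (simp add: q_def \<theta>_def abs_mult)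
      qed (simp add: q_def)
    qed
  qed
  have tan3: "summable (\<lambda>j. exp (- (pi * (1 / y) / 24 * real j)))"
    using assms by (intro summable_exp_minus_mult_of_nat) simp
  have q_lim: "(\<lambda>r. \<Sum>j. q j r) \<longlonglongrightarrow> sqrt 3 / 2 * eta_series (1 / y)"
  proof -
    note tannery = tannery_uniform[OF tan1 tan2 tan3]
    have "suminf s = sqrt 3 / 2 * eta_series (1 / y)"
      by (rule cos_series_eq_eta[of "1 / y", folded s_def]) (use assms tannery(1) in simp_all)
    with tannery(2) show ?thesis by simp
  qed
  \<comment> \<open>The factor 2 comes from \<open>polya_identity_half\<close>. The prefactor 6 r
    divided by sqrt (pi m) has limit 6 / sqrt (pi c) = sqrt (3 y).\<close>
  have ev: "eventually (\<lambda>r. 2 * (\<Sum>j. q j r) = 6 / sqrt (pi * (real (m r) / (real r)\<^sup>2)) * (\<Sum>k. p k r)) sequentially"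
    using m_pos pos
  proof eventually_elim
    case (elim r)
    have "(\<Sum>j. q j r) = (\<Sum>j<3 * r. q j r)"
      by (rule suminf_finite) (auto simp: q_def)
    also have "\<dots> = (\<Sum>j<3 * r. cos (pi * (2 * real j + 1) / (12 * r)) ^ (2 * m r) * cos (pi * (2 * real j + 1) / 6))"
      by (intro sum.cong) (auto simp: q_def)
    finally have "2 * (\<Sum>j. q j r) = 6 * r * (\<Sum>k. (- 1) ^ k * (b (m r) ((6 * k + 1) * r) - b (m r) ((6 * k + 5) * r)))"
      using polya_identity[OF elim(2), of "m r"] polya_identity_half[OF elim(2), of "m r"] by (simp add: b_def)
    also have "(\<lambda>k. (- 1) ^ k * (b (m r) ((6 * k + 1) * r) - b (m r) ((6 * k + 5) * r))) = (\<lambda>k. p k r / sqrt (pi * m r))"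
      using elim by (intro ext) (simp add: p_def diff_divide_distrib[symmetric] right_diff_distrib[symmetric])
    also have "(\<Sum>k. p k r / sqrt (pi * m r)) = (\<Sum>k. p k r) / sqrt (pi * m r)"
    proof (rule suminf_divide)
      show "summable (\<lambda>k. p k r)"
      proof (rule summable_comparison_test')
        show "summable M"
          unfolding M_def using assms by (intro summable_add summable_mult eta_series_summable) auto
        show "norm (p k r) \<le> M k" for k
          unfolding p_def M_def norm_mult norm_power norm_minus_cancel norm_one power_one mult_1
          using add_mono[OF b_bound[OF elim, of k 1] b_bound[OF elim, of k 5]]
          by (intro order_trans[OF norm_triangle_ineq4]) simp
      qed
    qed
    also have "6 * r * ((\<Sum>k. p k r) / sqrt (pi * m r)) = 6 / sqrt (pi * (real (m r) / (real r)\<^sup>2)) * (\<Sum>k. p k r)"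
      using elim by (simp add: real_sqrt_mult real_sqrt_divide)
    finally show ?case .
  qed
  have "(\<lambda>r. 6 / sqrt (pi * (real (m r) / (real r)\<^sup>2)) * (\<Sum>k. p k r)) \<longlonglongrightarrow> 6 / sqrt (pi * c) * eta_series y"
    using c by (intro tendsto_intros p_lim m_lim) auto
  then have "(\<lambda>r. 2 * (\<Sum>j. q j r)) \<longlonglongrightarrow> 6 / sqrt (pi * c) * eta_series y"
    unfolding tendsto_cong[OF ev] .
  moreover have "(\<lambda>r. 2 * (\<Sum>j. q j r)) \<longlonglongrightarrow> 2 * (sqrt 3 / 2 * eta_series (1 / y))"
    by (intro tendsto_intros q_lim)
  ultimately have "2 * (sqrt 3 / 2 * eta_series (1 / y)) = 6 / sqrt (pi * c) * eta_series y"
    using LIMSEQ_unique by blast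
  moreover have "6 / sqrt (pi * c) = sqrt 3 * sqrt y"
  proof -
    have "6 / sqrt (pi * c) = sqrt (36 / (pi * c))"
      by (simp add: real_sqrt_divide)
    also have "36 / (pi * c) = 3 * y" using assms by (simp add: c_def)
    finally show ?thesis by (simp add: real_sqrt_mult)
  qed
  ultimately show ?thesis by simp
qed

section \<open>The completed L-function\<close>

lemma of_nat_triangle: "real (triangle j) = real j * (real j + 1) / 2"
  by (induction j) (simp_all add: field_simps)

lemma alternating_fps_sums:
  fixes x c :: real
  assumes "strict_mono g"
  shows "(\<lambda>n. fps_nth (alternating_fps g) n * x ^ n) sums c \<longleftrightarrow> (\<lambda>j. (- 1) ^ j * x ^ g j) sums c"
  using sums_mono_reindex[OF assms, of "\<lambda>n. fps_nth (alternating_fps g) n * x ^ n" c] assms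
  by (simp add: alternating_fps_nth_eq_0)

text \<open>Completing the square: 24 times a generalised pentagonal number plus 1 is (6 j + 1)^2 or
  (6 j + 5)^2. At q = exp (- 2 pi y) the added 1 accounts for the factor exp (pi y / 12).\<close>

lemma pentagonal_fps_sums:
  assumes "y > 0"
  shows "(\<lambda>n. fps_nth pentagonal_fps n * exp (- (2 * pi * y)) ^ n) sums (exp (pi * y / 12) * eta_series y)"
proof -
  define q where "q = exp (- (2 * pi * y))"
  define u where "u a k = exp (- (pi * y * (6 * real k + a)\<^sup>2 / 12))" for a :: real and k :: nat
  have sm: "summable (\<lambda>k. (- 1) ^ k * u a k)" if "a > 0" for a
    by (rule summable_comparison_test'[OF eta_series_summable[OF assms that]])
       (simp add: u_def abs_mult)
  have "(- 1) ^ j * q ^ (j\<^sup>2 + triangle j) = exp (pi * y / 12) * ((- 1) ^ j * u 1 j)" for j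
  proof -
    have "real (j\<^sup>2 + triangle j) * (- (2 * pi * y)) = pi * y / 12 + (- (pi * y * (6 * real j + 1)\<^sup>2 / 12))"
      by (simp add: of_nat_triangle field_simps power2_eq_square)
    then show ?thesis unfolding q_def u_def exp_of_nat_mult[symmetric] by (simp only: exp_add) simp
  qed
  then have 1: "(\<lambda>j. (- 1) ^ j * q ^ (j\<^sup>2 + triangle j)) sums (exp (pi * y / 12) * (\<Sum>k. (- 1) ^ k * u 1 k))"
    by (simp only:) (intro sums_mult summable_sums sm, simp)
  have "(- 1) ^ j * q ^ ((Suc j)\<^sup>2 + triangle j) = exp (pi * y / 12) * ((- 1) ^ j * u 5 j)" for j
  proof -
    have "real ((Suc j)\<^sup>2 + triangle j) * (- (2 * pi * y)) = pi * y / 12 + (- (pi * y * (6 * real j + 5)\<^sup>2 / 12))"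
      by (simp add: of_nat_triangle field_simps power2_eq_square)
    then show ?thesis unfolding q_def u_def exp_of_nat_mult[symmetric] by (simp only: exp_add) simp
  qed
  then have 5: "(\<lambda>j. (- 1) ^ j * q ^ ((Suc j)\<^sup>2 + triangle j)) sums (exp (pi * y / 12) * (\<Sum>k. (- 1) ^ k * u 5 k))"
    by (simp only:) (intro sums_mult summable_sums sm, simp)
  have "eta_series y = (\<Sum>k. (- 1) ^ k * u 1 k) - (\<Sum>k. (- 1) ^ k * u 5 k)"
    unfolding suminf_diff[OF sm[of 1] sm[of 5], simplified] by (simp add: eta_series_def u_def right_diff_distrib)
  then have eta: "exp (pi * y / 12) * eta_series y = exp (pi * y / 12) * (\<Sum>k. (- 1) ^ k * u 1 k)
      - exp (pi * y / 12) * (\<Sum>k. (- 1) ^ k * u 5 k)"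
    by (simp only: right_diff_distrib)
  show ?thesis
    unfolding pentagonal_fps_def fps_sub_nth left_diff_distrib q_def[symmetric] eta
    by (intro sums_diff alternating_fps_sums[THEN iffD2] strict_mono_pentagonal 1 5)
qed

lemma conv_radius_pentagonal_fps: "fps_conv_radius (pentagonal_fps :: real fps) \<ge> 1"
  unfolding fps_conv_radius_def
proof (rule conv_radius_geI_ex')
  fix r :: real
  assume r: "0 < r" "ereal r < 1"
  show "summable (\<lambda>n. fps_nth pentagonal_fps n * of_real r ^ n :: real)"
  proof (rule summable_comparison_test')
    show "summable (\<lambda>n. 2 * r ^ n)" using r by (intro summable_mult summable_geometric) auto
    show "norm (fps_nth pentagonal_fps n * of_real r ^ n :: real) \<le> 2 * r ^ n" for n
      using norm_pentagonal_fps_nth_le[where 'a = real, of n] r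
      by (simp add: abs_mult power_abs mult_right_mono)
  qed
qed

lemma
  assumes "y > 0"
  shows tau_sums_eta_power:
      "(\<lambda>n. of_int (ramanujan_tau (Suc n)) * exp (- (2 * pi * real (Suc n) * y))) sums (eta_series y ^ 24)"
    and tau_abs_summable:
      "summable (\<lambda>n. \<bar>of_int (ramanujan_tau (Suc n))\<bar> * exp (- (2 * pi * real (Suc n) * y)))"
proof -
  define q where "q = exp (- (2 * pi * y))"
  have q: "0 < q" "q < 1" using assms by (auto simp: q_def)
  define P where "P = (pentagonal_fps :: real fps)"
  have "ereal (norm q) < fps_conv_radius P"
    using q conv_radius_pentagonal_fps by (simp add: P_def less_le_trans[of "ereal q" 1])
  then have radius: "ereal (norm q) < fps_conv_radius (P ^ 24)"
    using fps_conv_radius_power[of P 24] by (rule less_le_trans)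
  have term_eq: "c * exp (- (2 * pi * real (Suc n) * y)) = q * (c * q ^ n)" for c n
    by (simp add: q_def algebra_simps flip: exp_of_nat_mult exp_add)
  have coeff: "of_int (ramanujan_tau (Suc n)) = fps_nth (P ^ 24) n" for n
    unfolding ramanujan_tau_Suc of_int_pentagonal_power_nth P_def ..
  have "(\<lambda>n. fps_nth (P ^ 24) n * q ^ n) sums eval_fps (P ^ 24) q"
    using radius by (rule sums_eval_fps)
  also have "eval_fps (P ^ 24) q = eval_fps P q ^ 24"
    by (rule eval_fps_power) fact
  also have "eval_fps P q = exp (pi * y / 12) * eta_series y"
    using pentagonal_fps_sums[OF assms] by (simp add: eval_fps_def P_def q_def sums_iff)
  finally have "(\<lambda>n. q * (fps_nth (P ^ 24) n * q ^ n)) sums (q * (exp (pi * y / 12) * eta_series y) ^ 24)"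
    by (rule sums_mult)
  \<comment> \<open>The 24th power of exp (pi y / 12) is 1 / q and cancels the leading q of the
    discriminant form.\<close>
  also have "q * (exp (pi * y / 12) * eta_series y) ^ 24 = eta_series y ^ 24"
  proof -
    have "exp (pi * y / 12) ^ 24 = exp (2 * pi * y)" by (simp flip: exp_of_nat_mult)
    then show ?thesis by (simp add: q_def power_mult_distrib exp_minus)
  qed
  finally show "(\<lambda>n. of_int (ramanujan_tau (Suc n)) * exp (- (2 * pi * real (Suc n) * y))) sums (eta_series y ^ 24)"
    unfolding coeff term_eq .
  have "summable (\<lambda>n. norm (fps_nth (P ^ 24) n * q ^ n))"
    using radius unfolding fps_conv_radius_def by (rule abs_summable_in_conv_radius)
  then have "summable (\<lambda>n. q * norm (fps_nth (P ^ 24) n * q ^ n))" by (rule summable_mult)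
  then show "summable (\<lambda>n. \<bar>of_int (ramanujan_tau (Suc n))\<bar> * exp (- (2 * pi * real (Suc n) * y)))"
    unfolding term_eq coeff using q by (simp add: abs_mult)
qed

text \<open>The discriminant form Delta at the point i exp x; in this variable y -> 1 / y becomes x
  -> - x.\<close>

definition delta_exp :: "real \<Rightarrow> real" where
  "delta_exp x = eta_series (exp x) ^ 24"

lemma delta_exp_sums:
  "(\<lambda>n. of_int (ramanujan_tau (Suc n)) * exp (- (2 * pi * real (Suc n) * exp x))) sums delta_exp x"
  unfolding delta_exp_def by (rule tau_sums_eta_power) simp

lemma delta_exp_uminus: "delta_exp (- x) = exp (12 * x) * delta_exp x"
proof -
  have "sqrt (exp x) ^ 24 = exp (12 * x)"
  proof -
    have "sqrt (exp x) ^ 24 = (sqrt (exp x) ^ 2) ^ 12" by (simp only: power_mult[symmetric]) simp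
    also have "\<dots> = exp (12 * x)" by (simp flip: exp_of_nat_mult)
    finally show ?thesis .
  qed
  then show ?thesis
    using eta_series_transformation[of "exp x"]
    by (simp add: delta_exp_def exp_minus power_mult_distrib inverse_eq_divide)
qed

section \<open>Decay, Laplace transform and analytic continuation\<close>

lemma borel_measurable_delta_exp [measurable]: "delta_exp \<in> borel_measurable borel"
proof -
  have "delta_exp = (\<lambda>x. \<Sum>n. of_int (ramanujan_tau (Suc n)) * exp (- (2 * pi * real (Suc n) * exp x)))"
    using delta_exp_sums by (auto simp: sums_iff fun_eq_iff)
  also have "\<dots> \<in> borel_measurable borel" by measurable
  finally show ?thesis .
qed

text \<open>For x \<ge> 0, comparing the series at exp x termwise with the one at 1 gives doubly
  exponential decay, stronger than any exp (- N x). Negative x follows by reflection.\<close>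

lemma delta_exp_decay:
  obtains C where "\<And>x. \<bar>delta_exp x\<bar> \<le> C * exp (- (A * \<bar>x\<bar>))"
proof -
  define K where "K = (\<Sum>n. \<bar>of_int (ramanujan_tau (Suc n))\<bar> * exp (- (2 * pi * real (Suc n) * 1)))"
  have K: "K \<ge> 0" unfolding K_def by (intro suminf_nonneg tau_abs_summable) auto
  have bound: "\<bar>delta_exp x\<bar> \<le> K * exp 1 * exp (- exp x)" if "x \<ge> 0" for x
  proof -
    define y where "y = exp x"
    have y: "y \<ge> 1" using that by (simp add: y_def)
    have "\<bar>delta_exp x\<bar> \<le> (\<Sum>n. norm (of_int (ramanujan_tau (Suc n)) * exp (- (2 * pi * real (Suc n) * y))))"
      using summable_norm[of "\<lambda>n. of_int (ramanujan_tau (Suc n)) * exp (- (2 * pi * real (Suc n) * y))"]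
        tau_abs_summable[of y] y delta_exp_sums[of x]
      by (simp add: abs_mult sums_iff y_def)
    also have "\<dots> \<le> (\<Sum>n. \<bar>of_int (ramanujan_tau (Suc n))\<bar> * exp (- (2 * pi * real (Suc n) * 1)) * exp (1 - y))"
    proof (rule suminf_le)
      fix n
      have "1 * (y - 1) \<le> (2 * pi * real (Suc n)) * (y - 1)"
        using y pi_gt3 by (intro mult_right_mono) (auto simp: algebra_simps intro: add_increasing2)
      then have "exp (- (2 * pi * real (Suc n) * y)) \<le> exp (- (2 * pi * real (Suc n) * 1)) * exp (1 - y)"
        unfolding exp_add[symmetric] by (simp add: algebra_simps)
      then show "norm (of_int (ramanujan_tau (Suc n)) * exp (- (2 * pi * real (Suc n) * y))) \<le>
          \<bar>of_int (ramanujan_tau (Suc n))\<bar> * exp (- (2 * pi * real (Suc n) * 1)) * exp (1 - y)"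
        unfolding norm_mult by (simp only: mult.assoc) (intro mult_mono, auto)
      show "summable (\<lambda>n. norm (of_int (ramanujan_tau (Suc n)) * exp (- (2 * pi * real (Suc n) * y))))"
        using tau_abs_summable[of y] y by (simp add: abs_mult)
      show "summable (\<lambda>n. \<bar>of_int (ramanujan_tau (Suc n))\<bar> * exp (- (2 * pi * real (Suc n) * 1)) * exp (1 - y))"
        by (intro summable_mult2 tau_abs_summable) simp
    qed
    also have "\<dots> = K * exp (1 - y)"
      unfolding K_def by (intro suminf_mult2[symmetric] tau_abs_summable) simp
    also have "\<dots> = K * exp 1 * exp (- exp x)" by (simp add: y_def exp_diff exp_minus divide_inverse)
    finally show ?thesis .
  qed
  \<comment> \<open>Reflection costs a factor exp (12 |x|), which the extra 12 compensates.\<close>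
  define N where "N = nat \<lceil>A\<rceil> + 12"
  have N: "A \<le> real N - 12" unfolding N_def by (simp add: real_nat_ceiling_ge)
  have bound': "\<bar>delta_exp x\<bar> \<le> K * exp 1 * fact N * exp (- (real N * x))" if "x \<ge> 0" for x
  proof -
    have "exp x ^ N / fact N \<le> exp (exp x)"
    proof -
      have "(\<Sum>n\<in>{N}. exp x ^ n /\<^sub>R fact n) \<le> (\<Sum>n. exp x ^ n /\<^sub>R fact n)"
        by (rule sum_le_suminf[OF summable_exp_generic]) auto
      then show ?thesis
        using exp_converges[of "exp x"] by (simp add: sums_iff divide_inverse mult.commute)
    qed
    then have "exp (- exp x) \<le> fact N * exp (- (real N * x))"
      by (simp add: exp_minus field_simps flip: exp_of_nat_mult)
    from mult_left_mono[OF this, of "K * exp 1"] show ?thesis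
      using bound[OF that] K by (simp add: mult_ac)
  qed
  show thesis
  proof (rule that[of "K * exp 1 * fact N"])
    fix x
    show "\<bar>delta_exp x\<bar> \<le> K * exp 1 * fact N * exp (- (A * \<bar>x\<bar>))"
    proof (cases "x \<ge> 0")
      case True
      have "K * exp 1 * fact N * exp (- (real N * x)) \<le> K * exp 1 * fact N * exp (- (A * x))"
        using K N True by (intro mult_left_mono) (auto intro!: mult_right_mono)
      then show ?thesis using bound'[OF True] True by simp
    next
      case False
      have "\<bar>delta_exp x\<bar> = exp (12 * \<bar>x\<bar>) * \<bar>delta_exp \<bar>x\<bar>\<bar>"
        using delta_exp_uminus[of "- x"] False by (simp add: abs_mult)
      also have "\<dots> \<le> exp (12 * \<bar>x\<bar>) * (K * exp 1 * fact N * exp (- (real N * \<bar>x\<bar>)))"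
        by (intro mult_left_mono bound') auto
      also have "\<dots> = K * exp 1 * fact N * exp (- ((real N - 12) * \<bar>x\<bar>))"
        by (simp add: algebra_simps flip: exp_add)
      also have "\<dots> \<le> K * exp 1 * fact N * exp (- (A * \<bar>x\<bar>))"
        using K N by (intro mult_left_mono) (auto intro!: mult_right_mono)
      finally show ?thesis .
    qed
  qed
qed

text \<open>Euler's integral with t = exp x, whose Jacobian turns t^(s - 1) dt into exp (s x) dx.
  The scale a is then absorbed by translating x by ln a.\<close>

lemma Gamma_integral_exp:
  assumes "Re s > 0" "a > 0"
  shows "integrable lborel (\<lambda>x. exp (- of_real (a * exp x)) * exp (s * of_real x) :: complex)"
    and "(LBINT x. exp (- of_real (a * exp x)) * exp (s * of_real x)) = Gamma s * of_real a powr (- s)"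
proof -
  define g where "g a x = exp (- of_real (a * exp x)) * exp (s * of_real x)" for a x :: real
  have [measurable]: "g a \<in> borel_measurable borel" for a unfolding g_def by measurable
  let ?f = "\<lambda>t. complex_of_real t powr (s - 1) / of_real (exp t)"
  have range: "range (exp :: real \<Rightarrow> real) = {0<..}"
    by (auto simp: image_iff) (metis exp_ln)
  have g1: "\<bar>exp x\<bar> *\<^sub>R ?f (exp x) = g 1 x" for x :: real
  proof -
    have "complex_of_real (exp x) powr (s - 1) = exp ((s - 1) * of_real x)"
      by (simp add: powr_def Ln_of_real)
    then show ?thesis
      by (simp add: g_def scaleR_conv_of_real exp_of_real exp_minus exp_diff left_diff_distrib field_simps)
  qed
  have "?f absolutely_integrable_on {0<..}" "integral {0<..} ?f = Gamma s"
    using absolutely_integrable_Gamma_integral'[OF assms(1)] Gamma_integral_complex'[OF assms(1)]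
    by (auto intro: integral_unique)
  then have "(\<lambda>x::real. \<bar>exp x\<bar> *\<^sub>R ?f (exp x)) absolutely_integrable_on UNIV \<and>
      integral UNIV (\<lambda>x::real. \<bar>exp x\<bar> *\<^sub>R ?f (exp x)) = Gamma s"
    using has_absolute_integral_change_of_variables_real[of UNIV "exp :: real \<Rightarrow> real" exp ?f "Gamma s"]
    unfolding range by (auto intro!: derivative_eq_intros inj_onI)
  then have ai: "g 1 absolutely_integrable_on UNIV" and i: "integral UNIV (g 1) = Gamma s"
    unfolding g1 by auto
  \<comment> \<open>Absolute integrability refers to \<open>lebesgue\<close>; Borel measurability of
    the integrand brings it down to \<open>lborel\<close>.\<close>
  from ai have "integrable lebesgue (g 1)" by (simp add: set_integrable_def)
  then have int1: "integrable lborel (g 1)" by (simp add: integrable_completion)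
  have L: "integral\<^sup>L lborel (g 1) = Gamma s"
    using integral_lborel[OF int1] i by simp
  have shift: "g 1 (ln a + 1 * x) = of_real a powr s * g a x" for x
    using assms(2) by (simp add: g_def powr_def Ln_of_real exp_add distrib_left mult_ac)
  have nz: "of_real a powr s \<noteq> (0 :: complex)" using assms(2) by simp
  show "integrable lborel (\<lambda>x. exp (- of_real (a * exp x)) * exp (s * of_real x) :: complex)"
    using integrable_mult_right[OF lborel_integrable_real_affine[OF int1, of 1 "ln a"],
        of "inverse (of_real a powr s)"] nz
    unfolding shift g_def[symmetric] by (simp add: mult.assoc[symmetric] del: of_real_eq_0_iff)
  have "Gamma s = (LBINT x. g 1 (ln a + 1 * x))"
    using lborel_integral_real_affine[of 1 "g 1" "ln a"] L by simp
  also have "\<dots> = of_real a powr s * (LBINT x. g a x)" unfolding shift by simp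
  finally show "(LBINT x. exp (- of_real (a * exp x)) * exp (s * of_real x)) = Gamma s * of_real a powr (- s)"
    unfolding g_def[symmetric] using nz by (simp add: powr_minus field_simps)
qed

text \<open>For x \<le> 0, exp x is at most e times the integrand exp (- exp x) exp x of Gamma (1).
  A reflected copy handles the other side.\<close>

lemma integrable_exp_minus_abs: "integrable lborel (\<lambda>x::real. exp (- \<bar>x\<bar>))"
proof -
  define G where "G x = exp (- exp x) * exp x" for x :: real
  have "integrable lborel (\<lambda>x. exp (- of_real (1 * exp x)) * exp (1 * of_real x) :: complex)"
    by (rule Gamma_integral_exp) auto
  then have "integrable lborel (\<lambda>x. complex_of_real (G x))"
    by (simp add: G_def exp_of_real exp_minus)
  then have G: "integrable lborel G" using integrable_Re by fastforce
  have G': "integrable lborel (\<lambda>x. G (0 + - 1 * x))"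
    by (rule lborel_integrable_real_affine[OF G]) simp
  show ?thesis
  proof (rule Bochner_Integration.integrable_bound[of lborel "\<lambda>x. exp 1 * (G x + G (0 + - 1 * x))"])
    show "integrable lborel (\<lambda>x. exp 1 * (G x + G (0 + - 1 * x)))"
      using G G' by simp
    have Gpos: "G x \<ge> 0" for x by (simp add: G_def)
    have le: "exp x \<le> exp 1 * G x" if "x \<le> 0" for x
    proof -
      have "exp x \<le> 1" using that by simp
      then show ?thesis by (simp add: G_def flip: exp_add)
    qed
    have "exp (- \<bar>x\<bar>) \<le> exp 1 * (G x + G (- x))" for x
      using le[of x] le[of "- x"] Gpos[of x] Gpos[of "- x"]
      by (cases "x \<ge> 0") (auto simp: distrib_left intro: add_increasing add_increasing2)
    then show "AE x in lborel. norm (exp (- \<bar>x\<bar>)) \<le> norm (exp 1 * (G x + G (0 + - 1 * x)))"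
      using Gpos by simp
  qed simp
qed

text \<open>For large Re s this is (2 pi)^(-s) Gamma(s) F(s), the Mellin transform of Delta (i y)
  after y = exp x.\<close>

definition completed_L :: "complex \<Rightarrow> complex" where
  "completed_L s = (LBINT x. of_real (delta_exp x) * exp (s * of_real x))"

lemma integrable_delta_exp:
  "integrable lborel (\<lambda>x. \<bar>delta_exp x\<bar> * exp (A * \<bar>x\<bar>))"
proof -
  obtain C where C: "\<bar>delta_exp x\<bar> \<le> C * exp (- ((A + 1) * \<bar>x\<bar>))" for x
    using delta_exp_decay[of "A + 1"] by blast
  show ?thesis
  proof (rule Bochner_Integration.integrable_bound)
    show "integrable lborel (\<lambda>x. C * exp (- \<bar>x\<bar>))" using integrable_exp_minus_abs by simp
    show "AE x in lborel. norm (\<bar>delta_exp x\<bar> * exp (A * \<bar>x\<bar>)) \<le> norm (C * exp (- \<bar>x\<bar>))"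
    proof (rule AE_I2)
      fix x
      have "\<bar>delta_exp x\<bar> * exp (A * \<bar>x\<bar>) \<le> C * exp (- ((A + 1) * \<bar>x\<bar>)) * exp (A * \<bar>x\<bar>)"
        by (intro mult_right_mono C) simp
      also have "\<dots> = C * exp (- \<bar>x\<bar>)" by (simp add: algebra_simps flip: exp_add)
      finally show "norm (\<bar>delta_exp x\<bar> * exp (A * \<bar>x\<bar>)) \<le> norm (C * exp (- \<bar>x\<bar>))" by simp
    qed
  qed measurable
qed

lemma completed_L_reflect: "completed_L (12 - s) = completed_L s"
proof -
  have "completed_L (12 - s) = (LBINT x. of_real (delta_exp (- x)) * exp ((12 - s) * of_real (- x)))"
    unfolding completed_L_def
    by (subst lborel_integral_real_affine[where c = "- 1" and t = 0]) auto
  also have "\<dots> = completed_L s"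
    unfolding completed_L_def
  proof (rule Bochner_Integration.integral_cong[OF refl])
    fix x
    have "exp (12 * complex_of_real x) * exp ((12 - s) * of_real (- x)) = exp (s * of_real x)"
      unfolding exp_add[symmetric] by (simp add: algebra_simps)
    moreover have "complex_of_real (delta_exp (- x)) = exp (12 * complex_of_real x) * of_real (delta_exp x)"
      by (simp add: delta_exp_uminus flip: exp_of_real)
    ultimately show "of_real (delta_exp (- x)) * exp ((12 - s) * of_real (- x)) = of_real (delta_exp x) * exp (s * of_real x)"
      by (simp only: mult_ac)
  qed
  finally show ?thesis .
qed

text \<open>Expand exp (s x) and integrate termwise: partial sums of the norms stay below |delta_exp
  x| exp (|s| |x|), which is integrable. The result is a power series in s converging
  everywhere.\<close>

lemma holomorphic_completed_L: "completed_L holomorphic_on UNIV"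
proof -
  define a :: "nat \<Rightarrow> complex" where "a k = (LBINT x. of_real (delta_exp x) * (of_real x ^ k /\<^sub>R fact k))" for k :: nat
  have sums: "(\<lambda>k. a k * s ^ k) sums completed_L s" for s :: complex
  proof -
    define f where "f k x = of_real (delta_exp x) * ((s * of_real x) ^ k /\<^sub>R fact k)" for k and x :: real
    have [measurable]: "f k \<in> borel_measurable borel" for k unfolding f_def by measurable
    have norm_f: "norm (f k x) = \<bar>delta_exp x\<bar> * ((norm s * \<bar>x\<bar>) ^ k /\<^sub>R fact k)" for k x
      by (simp add: f_def norm_mult norm_power)
    have part: "(\<Sum>k<n. norm (f k x)) \<le> \<bar>delta_exp x\<bar> * exp (norm s * \<bar>x\<bar>)" for n x
    proof -
      have "(\<Sum>k<n. (norm s * \<bar>x\<bar>) ^ k /\<^sub>R fact k) \<le> (\<Sum>k. (norm s * \<bar>x\<bar>) ^ k /\<^sub>R fact k)"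
        by (rule sum_le_suminf[OF summable_exp_generic]) auto
      also have "\<dots> = exp (norm s * \<bar>x\<bar>)"
        using exp_converges[of "norm s * \<bar>x\<bar>"] by (simp add: sums_iff)
      finally show ?thesis unfolding norm_f sum_distrib_left[symmetric] by (intro mult_left_mono) auto
    qed
    have one: "norm (f k x) \<le> \<bar>delta_exp x\<bar> * exp (norm s * \<bar>x\<bar>)" for k x
      using part[of x "Suc k"] sum_nonneg[of "{..<k}" "\<lambda>k. norm (f k x)"] by simp
    have int_f: "integrable lborel (f k)" for k
    proof (rule Bochner_Integration.integrable_bound[OF integrable_delta_exp[of "norm s"]])
      show "AE x in lborel. norm (f k x) \<le> norm (\<bar>delta_exp x\<bar> * exp (norm s * \<bar>x\<bar>))"
        using one by (intro AE_I2) (metis abs_ge_self order_trans real_norm_def)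
    qed measurable
    have "(\<lambda>k. integral\<^sup>L lborel (f k)) sums (LBINT x. (\<Sum>k. f k x))"
    proof (rule sums_integral[OF int_f])
      show "AE x in lborel. summable (\<lambda>k. norm (f k x))"
        unfolding norm_f by (intro AE_I2 summable_mult summable_exp_generic)
      show "summable (\<lambda>k. LBINT x. norm (f k x))"
      proof (rule summableI_nonneg_bounded)
        fix n
        have "(\<Sum>k<n. LBINT x. norm (f k x)) = (LBINT x. (\<Sum>k<n. norm (f k x)))"
          using int_f by (intro Bochner_Integration.integral_sum[symmetric] integrable_norm)
        also have "\<dots> \<le> (LBINT x. \<bar>delta_exp x\<bar> * exp (norm s * \<bar>x\<bar>))"
          using int_f part by (intro integral_mono integrable_delta_exp Bochner_Integration.integrable_sum integrable_norm) auto
        finally show "(\<Sum>k<n. LBINT x. norm (f k x)) \<le> (LBINT x. \<bar>delta_exp x\<bar> * exp (norm s * \<bar>x\<bar>))" .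
      qed simp
    qed
    also have "(\<lambda>k. integral\<^sup>L lborel (f k)) = (\<lambda>k. a k * s ^ k)"
    proof
      fix k
      have "integral\<^sup>L lborel (f k) = (LBINT x. (of_real (delta_exp x) * (of_real x ^ k /\<^sub>R fact k)) * s ^ k)"
        by (simp add: f_def[abs_def] power_mult_distrib mult_ac)
      then show "integral\<^sup>L lborel (f k) = a k * s ^ k" by (simp add: a_def)
    qed
    also have "(LBINT x. (\<Sum>k. f k x)) = completed_L s"
      unfolding completed_L_def
    proof (rule Bochner_Integration.integral_cong[OF refl])
      fix x
      have "(\<lambda>k. f k x) sums (of_real (delta_exp x) * exp (s * of_real x))"
        unfolding f_def by (intro sums_mult exp_converges)
      then show "(\<Sum>k. f k x) = of_real (delta_exp x) * exp (s * of_real x)"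
        by (simp add: sums_iff)
    qed
    finally show ?thesis .
  qed
  have "completed_L holomorphic_on ball 0 r" for r
    using sums by (intro power_series_holomorphic[where a = a]) simp
  then have "completed_L holomorphic_on (\<Union>r. ball 0 r)"
    by (intro holomorphic_on_UN_open) auto
  moreover have "(\<Union>r. ball 0 r) = (UNIV :: complex set)"
    by (auto intro: gt_ex)
  ultimately show ?thesis by simp
qed

text \<open>Integrate the series for \<open>delta_exp\<close> termwise, each term being a Gamma
  integral. The norms integrate to the analogous terms at Re s, which
  \<open>ramanujan_tau_bound\<close> compares with n^(24 - Re s); 30 lies safely beyond the
  threshold 25.\<close>

lemma completed_L_sums:
  assumes "Re s > 30"
  shows "(\<lambda>n. of_int (ramanujan_tau (Suc n)) * (Gamma s * of_real (2 * pi * real (Suc n)) powr (- s))) sums completed_L s"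
proof -
  define a where "a n = 2 * pi * real (Suc n)" for n
  have a: "a n > 0" for n by (simp add: a_def)
  define t where "t n = (of_int (ramanujan_tau (Suc n)) :: real)" for n
  define f where "f n x = complex_of_real (t n) * (exp (- of_real (a n * exp x)) * exp (s * of_real x))" for n and x :: real
  have s: "Re s > 0" using assms by simp
  have int_f: "integrable lborel (f n)" for n
    unfolding f_def using Gamma_integral_exp(1)[OF s a] by simp
  have norm_f: "norm (f n x) = \<bar>t n\<bar> * exp (- (a n * exp x)) * exp (Re s * x)" for n x
    by (simp add: f_def norm_mult)
  have int_norm: "(LBINT x. norm (f n x)) = \<bar>t n\<bar> * norm (Gamma (of_real (Re s) :: complex)) * a n powr (- Re s)" for n
  proof -
    define h where "h x = exp (- (a n * exp x)) * exp (Re s * x)" for x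
    have "complex_of_real (LBINT x. h x) = (LBINT x. exp (- of_real (a n * exp x)) * exp (of_real (Re s) * of_real x))"
      unfolding integral_complex_of_real[symmetric] by (simp add: h_def exp_of_real[symmetric])
    also have "\<dots> = Gamma (of_real (Re s)) * of_real (a n) powr (- of_real (Re s))"
      using s a by (intro Gamma_integral_exp(2)) auto
    finally have "norm (complex_of_real (LBINT x. h x)) = norm (Gamma (of_real (Re s) :: complex)) * a n powr (- Re s)"
      using a[of n] by (simp add: norm_mult norm_powr_real_powr)
    moreover have "(LBINT x. h x) \<ge> 0" by (intro Bochner_Integration.integral_nonneg) (simp add: h_def)
    moreover have "(LBINT x. norm (f n x)) = \<bar>t n\<bar> * (LBINT x. h x)"
      unfolding norm_f by (simp add: h_def mult.assoc)
    ultimately show ?thesis by simp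
  qed
  have "(\<lambda>n. integral\<^sup>L lborel (f n)) sums (LBINT x. (\<Sum>n. f n x))"
  proof (rule sums_integral[OF int_f])
    have "summable (\<lambda>n. \<bar>t n\<bar> * exp (- (a n * exp x)) * exp (Re s * x))" for x
      using tau_abs_summable[of "exp x"] by (intro summable_mult2) (simp add: t_def a_def)
    then show "AE x in lborel. summable (\<lambda>n. norm (f n x))" unfolding norm_f by (intro AE_I2)
    define D where "D = 2 ^ 24 * norm (Gamma (of_real (Re s) :: complex)) * (2 * pi) powr (- Re s)"
    show "summable (\<lambda>n. LBINT x. norm (f n x))"
    proof (rule summable_comparison_test')
      have "summable (\<lambda>n. real n powr (24 - Re s))" using assms by (simp add: summable_real_powr_iff)
      then have "summable (\<lambda>n. real (Suc n) powr (24 - Re s))" by (subst summable_Suc_iff)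
      then show "summable (\<lambda>n. D * real (Suc n) powr (24 - Re s))" by (rule summable_mult)
      fix n
      have "\<bar>t n\<bar> * norm (Gamma (of_real (Re s) :: complex)) * a n powr (- Re s) \<le>
          2 ^ 24 * real (Suc n) ^ 24 * norm (Gamma (of_real (Re s) :: complex)) * a n powr (- Re s)"
        unfolding t_def by (intro mult_right_mono ramanujan_tau_bound) auto
      also have "\<dots> = D * (real (Suc n) powr 24 * real (Suc n) powr (- Re s))"
        using powr_mult[of "2 * pi" "real (Suc n)" "- Re s"]
        unfolding a_def by (simp only: D_def powr_numeral mult_ac)
      also have "real (Suc n) powr 24 * real (Suc n) powr (- Re s) = real (Suc n) powr (24 - Re s)"
        by (simp only: powr_add[symmetric] diff_conv_add_uminus)
      finally show "norm (LBINT x. norm (f n x)) \<le> D * real (Suc n) powr (24 - Re s)"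
        unfolding int_norm by simp
    qed
  qed
  also have "(\<lambda>n. integral\<^sup>L lborel (f n)) = (\<lambda>n. of_int (ramanujan_tau (Suc n)) * (Gamma s * of_real (2 * pi * real (Suc n)) powr (- s)))"
    unfolding f_def integral_mult_right_zero Gamma_integral_exp(2)[OF s a] by (simp add: t_def a_def)
  also have "(LBINT x. (\<Sum>n. f n x)) = completed_L s"
    unfolding completed_L_def
  proof (rule Bochner_Integration.integral_cong[OF refl])
    fix x
    have "(\<lambda>n. complex_of_real (t n * exp (- (a n * exp x))) * exp (s * of_real x)) sums (of_real (delta_exp x) * exp (s * of_real x))"
      by (intro sums_mult2 sums_of_real) (use delta_exp_sums[of x] in \<open>simp add: t_def a_def\<close>)
    moreover have "complex_of_real (t n * exp (- (a n * exp x))) * exp (s * of_real x) = f n x" for n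
      by (simp add: f_def exp_of_real[symmetric] mult.assoc)
    ultimately show "(\<Sum>n. f n x) = of_real (delta_exp x) * exp (s * of_real x)"
      by (simp add: sums_iff)
  qed
  finally show ?thesis .
qed

section \<open>A lower bound for a ratio of Gamma values\<close>

text \<open>As a function of x the left side vanishes at 0 and is convex on [0, 1/2], so it lies
  below its chord. The end values, at u + 1/2 and u - 1/2, telescope when u runs through 6 +
  k.\<close>

lemma ln_quadratic_symmetric_diff_le:
  fixes u x :: real
  assumes "0 < x" "x < 1 / 2" "u \<ge> 6"
  shows "ln ((u + x)\<^sup>2 + 10) - ln ((u - x)\<^sup>2 + 10) \<le>
    2 * x * (ln ((u + 1 / 2)\<^sup>2 + 10) - ln ((u - 1 / 2)\<^sup>2 + 10))"
proof -
  define W where "W x = ln ((u + x)\<^sup>2 + 10) - ln ((u - x)\<^sup>2 + 10)" for x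
  define g where "g v = 2 * v / (v\<^sup>2 + 10)" for v :: real
  define g' where "g' v = (20 - 2 * v\<^sup>2) / (v\<^sup>2 + 10)\<^sup>2" for v :: real
  have pos: "v\<^sup>2 + 10 > 0" for v :: real by (smt (verit) zero_le_power2)
  have W': "(W has_real_derivative g (u + x) + g (u - x)) (at x)" for x
    unfolding W_def g_def using pos[of "u + x"] pos[of "u - x"]
    by (auto intro!: derivative_eq_intros simp: field_simps)
  have gd: "(g has_real_derivative g' v) (at v)" for v
    unfolding g_def g'_def using pos[of v]
    by (auto intro!: derivative_eq_intros simp: field_simps power2_eq_square)
  have W'': "((\<lambda>x. g (u + x) + g (u - x)) has_real_derivative g' (u + x) - g' (u - x)) (at x)" for x
    by (auto intro!: derivative_eq_intros DERIV_chain2[OF gd])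
  \<comment> \<open>With P = 1 / (v^2 + 10), \<open>g' v\<close> is 40 P^2 - 2 P, decreasing in P
    for P \<le> 1/40, that is for v^2 \<ge> 30. The points that occur are at least 11/2, and
    (11/2)^2 = 30.25.\<close>
  have g'_mono: "g' a \<le> g' b" if "30 \<le> a\<^sup>2" "a\<^sup>2 \<le> b\<^sup>2" for a b :: real
  proof -
    define p q where "p = a\<^sup>2 + 10" and "q = b\<^sup>2 + 10"
    have pq: "40 \<le> p" "p \<le> q" using that by (auto simp: p_def q_def)
    have *: "g' a = 40 * (1 / p)\<^sup>2 - 2 * (1 / p)" "g' b = 40 * (1 / q)\<^sup>2 - 2 * (1 / q)"
    proof -
      have "g' a = (40 - 2 * p) / p\<^sup>2" "g' b = (40 - 2 * q) / q\<^sup>2"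
        by (simp_all add: g'_def p_def q_def)
      then show "g' a = 40 * (1 / p)\<^sup>2 - 2 * (1 / p)" "g' b = 40 * (1 / q)\<^sup>2 - 2 * (1 / q)"
        using pq by (simp_all add: divide_simps power2_eq_square)
    qed
    define P Q where "P = 1 / p" and "Q = 1 / q"
    have PQ: "Q \<le> P" "P \<le> 1 / 40" using pq by (auto simp: P_def Q_def field_simps)
    have "0 \<le> (P - Q) * (2 - 40 * (P + Q))" using PQ by (intro mult_nonneg_nonneg) auto
    then show ?thesis unfolding * P_def[symmetric] Q_def[symmetric]
      by (simp add: algebra_simps power2_eq_square)
  qed
  have cvx: "convex_on {0..1/2} W"
  proof (rule f''_ge0_imp_convex[OF _ W' W''])
    fix x :: real assume x: "x \<in> {0..1/2}"
    have "(11 / 2)\<^sup>2 \<le> (u - x)\<^sup>2" using x assms by (intro power_mono) auto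
    moreover have "(u - x)\<^sup>2 \<le> (u + x)\<^sup>2" using x assms by (intro power_mono) auto
    ultimately have "g' (u - x) \<le> g' (u + x)"
      by (intro g'_mono) (auto simp: power2_eq_square)
    then show "0 \<le> g' (u + x) - g' (u - x)" by simp
  qed auto
  have "W ((1 - 2 * x) *\<^sub>R 0 + (2 * x) *\<^sub>R (1 / 2)) \<le> (1 - 2 * x) * W 0 + (2 * x) * W (1 / 2)"
    using assms by (intro convex_onD[OF cvx]) auto
  then show ?thesis by (simp add: W_def)
qed

text \<open>By Gauss's product the ratio is the limit of n^(2 x) times quotients of moduli. Bounds
  exp (B (Suc k) - B k) for these telescope, and B (n + 1) cancels the growth of n^(2 x), leaving
  exp (B 0).\<close>

lemma Gamma_ratio_lower_bound:
  assumes "0 < x" "x < 1 / 2" "t\<^sup>2 \<ge> 10"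
  shows "norm (Gamma (Complex (6 - x) t)) * (161 / 4) powr x \<le> norm (Gamma (Complex (6 + x) t))"
proof (rule LIMSEQ_le)
  define P where "P y n = (\<Prod>k<n+1. norm (Complex (y + real k) t))" for y n
  have ns: "norm (Gamma_series (Complex y t) n) = fact n * real n powr y / P y n"
    if "n > 0" for y n
  proof -
    have "norm (pochhammer (Complex y t) (n + 1)) = P y n"
      unfolding pochhammer_prod P_def prod_norm[symmetric]
      by (intro prod.cong) (auto simp: complex_eq_iff intro!: arg_cong[of _ _ norm])
    moreover have "norm (exp (Complex y t * of_real (ln (real n)))) = real n powr y"
      using that by (simp add: powr_def)
    ultimately show ?thesis
      unfolding Gamma_series_def by (simp add: norm_divide norm_mult del: norm_exp_eq_Re)
  qed
  have pos: "v\<^sup>2 + 10 > 0" for v :: real by (smt (verit) zero_le_power2)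
  \<comment> \<open>Chosen so that 2 (B (Suc k) - B k) is the chord bound at u = 6 + k, with u + 1/2
    = k + 13/2 and u - 1/2 = k + 11/2.\<close>
  define B where "B k = x * ln ((real k + 11 / 2)\<^sup>2 + 10)" for k
  have Ppos: "P y n > 0" if "y > 0" for y n
    unfolding P_def using that by (intro prod_pos) (auto simp: complex_eq_iff)
  have step: "norm (Complex (6 + x + real k) t) \<le>
      norm (Complex (6 - x + real k) t) * exp (B (Suc k) - B k)" for k
  proof -
    define a b where "a = (6 + real k + x)\<^sup>2" and "b = (6 + real k - x)\<^sup>2"
    have ab: "b \<le> a" unfolding a_def b_def using assms by (intro power_mono) auto
    have b0: "b \<ge> 0" by (simp add: b_def)
    have "ln (a + 10) - ln (b + 10) \<le> 2 * (B (Suc k) - B k)"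
      using ln_quadratic_symmetric_diff_le[of x "6 + real k"] assms
      by (simp add: a_def b_def B_def algebra_simps)
    then have "ln ((a + 10) / (b + 10)) \<le> 2 * (B (Suc k) - B k)"
      using ab b0 by (simp add: ln_div)
    then have "(a + 10) / (b + 10) \<le> exp (2 * (B (Suc k) - B k))"
      using ab b0 by (subst (asm) exp_le_cancel_iff[symmetric]) simp
    \<comment> \<open>For a \<ge> b the quotient (a + v) / (b + v) decreases in v, so v = 10 is the
      extreme case.\<close>
    moreover have "(a + t\<^sup>2) / (b + t\<^sup>2) \<le> (a + 10) / (b + 10)"
    proof -
      have "(a + t\<^sup>2) * (b + 10) \<le> (a + 10) * (b + t\<^sup>2)"
        using mult_nonneg_nonneg[of "a - b" "t\<^sup>2 - 10"] ab assms by (simp add: algebra_simps)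
      then show ?thesis using ab b0 assms by (simp add: divide_simps mult.commute)
    qed
    ultimately have "(a + t\<^sup>2) / (b + t\<^sup>2) \<le> exp (2 * (B (Suc k) - B k))" by linarith
    then have "a + t\<^sup>2 \<le> (b + t\<^sup>2) * (exp (B (Suc k) - B k))\<^sup>2"
      using b0 assms unfolding exp_double by (simp add: pos_divide_le_eq add_nonneg_pos mult.commute)
    then have "sqrt (a + t\<^sup>2) \<le> sqrt ((b + t\<^sup>2) * (exp (B (Suc k) - B k))\<^sup>2)"
      by (rule real_sqrt_le_mono)
    also have "\<dots> = sqrt (b + t\<^sup>2) * exp (B (Suc k) - B k)"
      by (simp add: real_sqrt_mult)
    finally show ?thesis
      by (simp add: cmod_def a_def b_def algebra_simps)
  qed
  have ratio: "P (6 + x) n \<le> P (6 - x) n * exp (B (n + 1) - B 0)" for n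
  proof -
    have "P (6 + x) n \<le> (\<Prod>k<n+1. norm (Complex (6 - x + real k) t) * exp (B (Suc k) - B k))"
      unfolding P_def by (intro prod_mono conjI step norm_ge_zero)
    also have "\<dots> = P (6 - x) n * (\<Prod>k<n+1. exp (B (Suc k) - B k))"
      unfolding P_def by (rule prod.distrib)
    also have "(\<Prod>k<n+1. exp (B (Suc k) - B k)) = exp (B (n + 1) - B 0)"
      by (subst exp_sum[symmetric]) (simp_all only: finite_lessThan sum_lessThan_telescope)
    finally show ?thesis .
  qed
  let ?L = "\<lambda>n. norm (Gamma_series (Complex (6 - x) t) n) * exp (B 0) * (real n powr (2 * x) * exp (- B (n + 1)))"
  show "(\<lambda>n. norm (Gamma_series (Complex (6 + x) t) n)) \<longlonglongrightarrow> norm (Gamma (Complex (6 + x) t))"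
    by (intro tendsto_intros)
  have "(\<lambda>n. (real n powr (2 * x) * exp (- B (n + 1)))) \<longlonglongrightarrow> 1"
  proof -
    have "(\<lambda>n. exp (x * (ln ((real n)\<^sup>2 / ((real n + 13 / 2)\<^sup>2 + 10))))) \<longlonglongrightarrow> exp (x * ln 1)"
    proof (intro tendsto_intros)
      show "(\<lambda>n. (real n)\<^sup>2 / ((real n + 13 / 2)\<^sup>2 + 10)) \<longlonglongrightarrow> 1" by real_asymp
    qed auto
    moreover have "eventually (\<lambda>n. exp (x * (ln ((real n)\<^sup>2 / ((real n + 13 / 2)\<^sup>2 + 10)))) =
        real n powr (2 * x) * exp (- B (n + 1))) sequentially"
      using eventually_gt_at_top[of 0]
    proof eventually_elim
      case (elim n)
      have eq: "real (n + 1) + 11 / 2 = real n + 13 / 2" by simp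
      have "ln ((real n)\<^sup>2 / ((real n + 13 / 2)\<^sup>2 + 10)) = 2 * ln n - ln ((real n + 13 / 2)\<^sup>2 + 10)"
        using elim pos[of "real n + 13 / 2"] by (simp add: ln_div ln_realpow)
      then have "x * ln ((real n)\<^sup>2 / ((real n + 13 / 2)\<^sup>2 + 10)) = 2 * x * ln n - B (n + 1)"
        unfolding B_def eq by (simp only:) (simp add: algebra_simps)
      moreover have "real n powr (2 * x) = exp (2 * x * ln n)" using elim by (simp add: powr_def)
      moreover have "exp (2 * x * ln n - B (n + 1)) = exp (2 * x * ln n) * exp (- B (n + 1))"
        by (simp flip: exp_add)
      ultimately show ?case by (simp only:)
    qed
    ultimately show ?thesis by (simp add: tendsto_cong)
  qed
  \<comment> \<open>Here (11/2)^2 + 10 = 161/4.\<close>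
  moreover have "exp (B 0) = (161 / 4) powr x"
    by (simp add: B_def powr_def power2_eq_square)
  ultimately show "?L \<longlonglongrightarrow> norm (Gamma (Complex (6 - x) t)) * (161 / 4) powr x"
    using tendsto_mult[OF tendsto_mult[OF tendsto_norm[OF Gamma_series_LIMSEQ[of "Complex (6 - x) t"]]
          tendsto_const[of "exp (B 0)"]]] by fastforce
  show "\<exists>N. \<forall>n\<ge>N. ?L n \<le> norm (Gamma_series (Complex (6 + x) t) n)"
  proof (intro exI[of _ 1] allI impI)
    fix n :: nat assume "n \<ge> 1"
    then have n: "n > 0" by simp
    have E: "exp (B 0) * exp (- B (n + 1)) = inverse (exp (B (n + 1) - B 0))"
      by (simp add: exp_minus[symmetric] exp_add[symmetric])
    have "?L n = fact n * real n powr (6 + x) / (P (6 - x) n * exp (B (n + 1) - B 0))"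
    proof -
      have "real n powr (6 - x) * real n powr (2 * x) = real n powr (6 + x)"
        by (simp add: add.commute flip: powr_add)
      moreover have "?L n = fact n * (real n powr (6 - x) * real n powr (2 * x)) / P (6 - x) n
          * (exp (B 0) * exp (- B (n + 1)))"
        unfolding ns[OF n] by simp
      ultimately show ?thesis unfolding E by (simp add: divide_inverse mult_ac)
    qed
    also have "\<dots> \<le> fact n * real n powr (6 + x) / P (6 + x) n"
      using ratio[of n] Ppos[of "6 + x" n] Ppos[of "6 - x" n] assms
      by (intro divide_left_mono mult_nonneg_nonneg mult_pos_pos) auto
    also have "\<dots> = norm (Gamma_series (Complex (6 + x) t) n)"
      by (simp add: ns[OF n])
    finally show "?L n \<le> norm (Gamma_series (Complex (6 + x) t) n)" .
  qed
qed

text \<open>Numerically 39.48 against 40.25. The bound 3.17 for pi is fine enough, as 6.34^2 =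
  40.1956.\<close>

lemma four_pi_squared_less: "(2 * pi)\<^sup>2 < 161 / 4"
proof -
  have "pi < 3.17" using pi_approx by simp
  then have "(2 * pi)\<^sup>2 < (6.34)\<^sup>2" by (intro power_strict_mono) auto
  then show ?thesis by (simp add: power2_eq_square)
qed

section \<open>The functional equation and the inequality\<close>

text \<open>Multiplying by the entire function \<open>rGamma\<close> instead of dividing by Gamma
  makes holomorphy on the whole plane immediate.\<close>

definition ramanujan_L_witness :: "complex \<Rightarrow> complex" where
  "ramanujan_L_witness s = of_real (2 * pi) powr s * rGamma s * completed_L s"

lemma holomorphic_ramanujan_L_witness: "ramanujan_L_witness holomorphic_on UNIV"
  unfolding ramanujan_L_witness_def
  by (intro holomorphic_intros holomorphic_completed_L)

lemma ramanujan_L_witness_sums: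
  assumes "Re s > 30"
  shows "(\<lambda>n. of_int (ramanujan_tau (Suc n)) * of_nat (Suc n) powr (- s)) sums ramanujan_L_witness s"
proof -
  have nz: "Gamma s \<noteq> 0" using assms by (auto simp: Gamma_eq_zero_iff elim!: nonpos_Ints_cases)
  have "of_real (2 * pi) powr s * rGamma s * (c * (Gamma s * of_real (2 * pi * real (Suc n)) powr (- s))) =
      c * of_nat (Suc n) powr (- s)" for c n
  proof -
    have "of_real (2 * pi * real (Suc n)) powr (- s) =
        of_real (2 * pi) powr (- s) * of_nat (Suc n) powr (- s)"
      unfolding of_real_mult[of "2 * pi"] by (subst powr_times_real) auto
    moreover have "complex_of_real (2 * pi) powr s * of_real (2 * pi) powr (- s) = 1"
      by (simp flip: powr_add)
    moreover have "rGamma s * Gamma s = 1" using nz by (simp add: rGamma_inverse_Gamma)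
    ultimately show ?thesis
      by (metis (no_types, opaque_lifting) mult.assoc mult.left_commute mult.left_neutral)
  qed
  then show ?thesis
    using sums_mult[OF completed_L_sums[OF assms], of "of_real (2 * pi) powr s * rGamma s"]
    unfolding ramanujan_L_witness_def by (simp only:)
qed

text \<open>Two candidates agree where both half-planes overlap, by uniqueness of sums, and then
  everywhere by the identity theorem.\<close>

lemma ramanujan_L_eq: "ramanujan_L = ramanujan_L_witness"
  unfolding ramanujan_L_def
proof (rule the_equality, intro conjI exI[of _ 30] allI impI)
  show "ramanujan_L_witness holomorphic_on UNIV" by (rule holomorphic_ramanujan_L_witness)
  show "(\<lambda>n. of_int (ramanujan_tau (Suc n)) * of_nat (Suc n) powr (- s)) sums ramanujan_L_witness s"
    if "30 < Re s" for s using that by (rule ramanujan_L_witness_sums)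
  fix f assume "f holomorphic_on UNIV \<and> (\<exists>c. \<forall>s. Re s > c \<longrightarrow>
      (\<lambda>n. of_int (ramanujan_tau (Suc n)) * of_nat (Suc n) powr (- s)) sums f s)"
  then obtain c where f: "f holomorphic_on UNIV" "\<And>s. Re s > c \<Longrightarrow>
      (\<lambda>n. of_int (ramanujan_tau (Suc n)) * of_nat (Suc n) powr (- s)) sums f s" by blast
  define H where "H = {s. Re s > max c 30}"
  have "f s = ramanujan_L_witness s" for s
  proof (rule analytic_continuation_open[of H UNIV f ramanujan_L_witness])
    show "open H" unfolding H_def by (rule open_halfspace_Re_gt)
    show "H \<noteq> {}" by (auto simp: H_def intro: exI[of _ "of_real (max c 30 + 1)"])
    show "f z = ramanujan_L_witness z" if "z \<in> H" for z
      using that f(2)[of z] ramanujan_L_witness_sums[of z] by (auto simp: H_def sums_unique2)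
  qed (auto intro: f holomorphic_ramanujan_L_witness)
  then show "f = ramanujan_L_witness" by blast
qed

theorem theorem2:
  fixes s :: complex
  assumes "6 < Re s" and "Re s < 13 / 2"
    and "Im s \<ge> 3.8085"
    and "ramanujan_L s \<noteq> 0"
  shows "norm (ramanujan_L (12 - s)) > norm (ramanujan_L s)"
proof -
  define x t where "x = Re s - 6" and "t = Im s"
  have x: "0 < x" "x < 1 / 2" using assms by (auto simp: x_def)
  have t: "t\<^sup>2 \<ge> 10"
    using power_mono[of "3.8085" t 2] assms(3) by (simp add: t_def power2_eq_square)
  have s: "s = Complex (6 + x) t" by (simp add: x_def t_def complex_eq_iff)
  \<comment> \<open>Gamma commutes with conjugation, so the reflected point may be replaced by 6 - x
    + i t, with the same imaginary part as s.\<close>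
  have cnj_s: "12 - s = cnj (Complex (6 - x) t)" by (simp add: s complex_eq_iff)
  \<comment> \<open>By \<open>completed_L_reflect\<close> this is a common factor of both sides;
    being nonzero, it preserves strict inequality.\<close>
  have L: "completed_L s \<noteq> 0" using assms(4) by (auto simp: ramanujan_L_eq ramanujan_L_witness_def)
  define G1 G2 where "G1 = norm (Gamma (Complex (6 - x) t))" and "G2 = norm (Gamma (Complex (6 + x) t))"
  have "Complex (6 - x) t \<notin> \<int>\<^sub>\<le>\<^sub>0" "Complex (6 + x) t \<notin> \<int>\<^sub>\<le>\<^sub>0"
    using x by (auto simp: complex_eq_iff elim!: nonpos_Ints_cases)
  then have "Gamma (Complex (6 - x) t) \<noteq> 0" "Gamma (Complex (6 + x) t) \<noteq> 0"
    by (simp_all add: Gamma_eq_zero_iff)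
  then have G: "G1 > 0" "G2 > 0" by (auto simp: G1_def G2_def)
  have "(2 * pi) powr (2 * x) = ((2 * pi) powr 2) powr x" by (rule powr_powr[symmetric])
  also have "(2 * pi) powr 2 = (2 * pi)\<^sup>2" by (rule powr_numeral) simp
  also have "((2 * pi)\<^sup>2) powr x < (161 / 4) powr x"
    using x four_pi_squared_less by (intro powr_less_mono2) auto
  finally have "G1 * (2 * pi) powr (2 * x) < G1 * (161 / 4) powr x" using G by simp
  also have "\<dots> \<le> G2" unfolding G1_def G2_def by (rule Gamma_ratio_lower_bound[OF x t])
  finally have "G1 * ((2 * pi) powr (6 - x) * (2 * pi) powr (2 * x)) < G2 * (2 * pi) powr (6 - x)"
    by simp
  then have main: "(2 * pi) powr (6 + x) * G1 < (2 * pi) powr (6 - x) * G2"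
    by (simp add: mult_ac add.commute flip: powr_add)
  have norm_s: "norm (ramanujan_L s) = (2 * pi) powr (6 + x) / G2 * norm (completed_L s)"
    by (simp add: ramanujan_L_eq ramanujan_L_witness_def norm_mult norm_powr_real_powr
        rGamma_inverse_Gamma norm_inverse G2_def s divide_inverse)
  have norm_12: "norm (ramanujan_L (12 - s)) = (2 * pi) powr (6 - x) / G1 * norm (completed_L s)"
    unfolding ramanujan_L_eq ramanujan_L_witness_def completed_L_reflect
    by (simp add: norm_mult norm_powr_real_powr rGamma_inverse_Gamma norm_inverse G1_def cnj_s
        divide_inverse flip: cnj_Gamma)
  have "(2 * pi) powr (6 + x) / G2 < (2 * pi) powr (6 - x) / G1"
    using main G by (simp add: field_simps)
  then show ?thesis unfolding norm_s norm_12 using L by (intro mult_strict_right_mono) auto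
qed

end
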